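(* Let $G$ be a group generated by a finite symmetric set $S$, with identity element $e$. Let $p=(p_g)_{g\in G}$ be a probability measure on $G$ with finite support generating $G$, and let $\mathcal P=\sum_{g\in G}p_g\,\rho(g)$ be the kernel of the associated convolution random walk. Then there exist an integer $r\ge 1$ and a coloured random walk on $G\times[r]$, with kernel $\tilde{\mathcal P}=\sum_{g\in G}\tilde p_g\otimes\rho(g)$, which linearizes $\mathcal P$. Moreover, if $\mathcal P$ is reversible, then $\tilde{\mathcal P}$ can be chosen to be also reversible.
   Context: Notation: $[r]=\{1,\dots,r\}$; elements of $[r]$ are called colours. $S$ is a fixed finite nonempty generating set of $G$, symmetric in the sense that $g\in S$ implies $g^{-1}\in S$. $\rho(g)$ is the operator $(\rho(g)f)(x)=f(xg)$ on $\ell^2(G)$. Convolution random walk: the Markov chain $(X_n)_{n\ge0}$ on $G$ with $\mathbb P[X_n=h\mid X_{n-1}=g]=p_{g^{-1}h}$; its kernel is $\mathcal P(g,h)=p_{g^{-1}h}$, i.e. $\mathcal P=\sum_g p_g\rho(g)$. The standing assumption that the support generates $G$ is understood as making the walk irreducible. $\mathcal P$ is reversible if $p_g=p_{g^{-1}}$ for all $g\in G$. Coloured random walk: let $(\tilde p_g)_{g\in G}$ be a family of $r\times r$ real matrices with non-negative entries such that $P=\sum_{g}\tilde p_g$ is a stochastic matrix. The associated coloured random walk is the Markov chain $(Y_n)_{n\ge0}$ on $G\times[r]$ with transition probabilities $\mathbb P[Y_n=(h,v)\mid Y_{n-1}=(g,u)]=\tilde p_{g^{-1}h}(u,v)$;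 its kernel is $\tilde{\mathcal P}=\sum_g\tilde p_g\otimes\rho(g)$. Its support is $\{g\in G:\tilde p_g\ne0\}$. It is nearest-neighbour if its support is included in $S$. It is quasi-irreducible if its support generates the whole group $G$ and the matrix $P$ is irreducible. If $\pi$ denotes the invariant probability measure of $P$ on $[r]$, the coloured walk is reversible if $\pi(u)\tilde p_g(u,v)=\pi(v)\tilde p_{g^{-1}}(v,u)$ for all $g\in G$, $u,v\in[r]$. Linearization: a coloured random walk $(Y_n)_{n\ge0}$ on $G\times[r]$ with kernel $\tilde{\mathcal P}$, assumed quasi-irreducible and nearest-neighbour, linearizes $(X_n)_{n\ge 0}$ (or $\tilde{\mathcal P}$ linearizes $\mathcal P$) if: (i) when $Y_0=(e,1)$ there exists a sequence of stopping times $(\tau_n)_{n\ge0}$ with $\tau_0=0$ such that $(Y_{\tau_n})_{n\ge0}$ is a realization of the random walk $(X_n)_{n\ge0}$ with initial condition $e$ (here $Y_{\tau_n}$ has constant colour $1$ and is identified with its $G$-coordinate); and (ii) these stopping times form a renewal process, that is, the variables $\tau_{n+1}-\tau_n$ are i.i.d. with finite mean. *)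

theory Defs
  imports "HOL-Probability.Probability" "HOL-Algebra.Generated_Groups"
begin

section \<open>Markov chains on a discrete state space\<close>

text \<open>
  The condition on transitions is the elementary Markov property
  \<open>P[X\<^sub>n\<^sub>+\<^sub>1 = y | X\<^sub>0 = x\<^sub>0, ..., X\<^sub>n = x\<^sub>n] = K(x\<^sub>n, y)\<close>, required for the histories of positive
  probability. It is adequate for countable state spaces, such as those built from a finitely
  generated group.
\<close>

definition markov_chain ::
  "'w measure \<Rightarrow> 's set \<Rightarrow> ('s \<Rightarrow> 's \<Rightarrow> real) \<Rightarrow> 's \<Rightarrow> (nat \<Rightarrow> 'w \<Rightarrow> 's) \<Rightarrow> bool"
where
  "markov_chain M E K x0 X \<longleftrightarrow>
     prob_space M \<and>
     (\<forall>n. X n \<in> M \<rightarrow>\<^sub>M count_space E) \<and>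
     (AE \<omega> in M. X 0 \<omega> = x0) \<and>
     (\<forall>n x y. (\<forall>i\<le>n. x i \<in> E) \<longrightarrow> y \<in> E \<longrightarrow> \<P>(\<omega> in M. \<forall>i\<le>n. X i \<omega> = x i) > 0 \<longrightarrow>
        \<P>(\<omega> in M. X (Suc n) \<omega> = y \<bar> \<forall>i\<le>n. X i \<omega> = x i) = K (x n) y)"

text \<open>
  The filtration is indexed by \<^typ>\<open>enat\<close> because stopping times may be infinite (on null sets);
  at index \<open>\<infinity>\<close> it is generated by the whole process.
\<close>

definition natural_filtration ::
  "'w measure \<Rightarrow> 's set \<Rightarrow> (nat \<Rightarrow> 'w \<Rightarrow> 's) \<Rightarrow> enat \<Rightarrow> 'w measure"
where
  "natural_filtration M E X t =
     sigma (space M) {X i -` A \<inter> space M | i A. enat i \<le> t \<and> A \<subseteq> E}"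


section \<open>Convolution and coloured random walks\<close>

definition conv_kernel :: "('a, 'b) monoid_scheme \<Rightarrow> 'a pmf \<Rightarrow> 'a \<Rightarrow> 'a \<Rightarrow> real"
where
  "conv_kernel G p g h = pmf p (inv\<^bsub>G\<^esub> g \<otimes>\<^bsub>G\<^esub> h)"

definition conv_reversible :: "('a, 'b) monoid_scheme \<Rightarrow> 'a pmf \<Rightarrow> bool"
where
  "conv_reversible G p \<longleftrightarrow> (\<forall>g\<in>carrier G. pmf p g = pmf p (inv\<^bsub>G\<^esub> g))"

text \<open>
  The set of colours is \<open>{1..r}\<close>. A family of \<open>r \<times> r\<close> matrices indexed by \<open>G\<close> is a function
  \<open>q :: 'a \<Rightarrow> nat \<Rightarrow> nat \<Rightarrow> real\<close>; only the values \<open>q g u v\<close> with \<open>g \<in> carrier G\<close> and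
  \<open>u, v \<in> {1..r}\<close> are relevant.
\<close>

definition colour_matrix :: "('a, 'b) monoid_scheme \<Rightarrow> ('a \<Rightarrow> nat \<Rightarrow> nat \<Rightarrow> real) \<Rightarrow> nat \<Rightarrow> nat \<Rightarrow> real"
where
  "colour_matrix G q u v = (\<Sum>\<^sub>\<infinity>g\<in>carrier G. q g u v)"

definition coloured_walk :: "('a, 'b) monoid_scheme \<Rightarrow> nat \<Rightarrow> ('a \<Rightarrow> nat \<Rightarrow> nat \<Rightarrow> real) \<Rightarrow> bool"
where
  "coloured_walk G r q \<longleftrightarrow>
     r \<ge> 1 \<and>
     (\<forall>g\<in>carrier G. \<forall>u\<in>{1..r}. \<forall>v\<in>{1..r}. q g u v \<ge> 0) \<and>
     (\<forall>u\<in>{1..r}. \<forall>v\<in>{1..r}. (\<lambda>g. q g u v) summable_on carrier G) \<and>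
     (\<forall>u\<in>{1..r}. (\<Sum>v\<in>{1..r}. colour_matrix G q u v) = 1)"

definition coloured_kernel ::
  "('a, 'b) monoid_scheme \<Rightarrow> ('a \<Rightarrow> nat \<Rightarrow> nat \<Rightarrow> real) \<Rightarrow> 'a \<times> nat \<Rightarrow> 'a \<times> nat \<Rightarrow> real"
where
  "coloured_kernel G q = (\<lambda>(g, u) (h, v). q (inv\<^bsub>G\<^esub> g \<otimes>\<^bsub>G\<^esub> h) u v)"

definition coloured_support ::
  "('a, 'b) monoid_scheme \<Rightarrow> nat \<Rightarrow> ('a \<Rightarrow> nat \<Rightarrow> nat \<Rightarrow> real) \<Rightarrow> 'a set"
where
  "coloured_support G r q = {g \<in> carrier G. \<exists>u\<in>{1..r}. \<exists>v\<in>{1..r}. q g u v \<noteq> 0}"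

definition nearest_neighbour ::
  "('a, 'b) monoid_scheme \<Rightarrow> 'a set \<Rightarrow> nat \<Rightarrow> ('a \<Rightarrow> nat \<Rightarrow> nat \<Rightarrow> real) \<Rightarrow> bool"
where
  "nearest_neighbour G S r q \<longleftrightarrow> coloured_support G r q \<subseteq> S"

definition irreducible_matrix :: "nat \<Rightarrow> (nat \<Rightarrow> nat \<Rightarrow> real) \<Rightarrow> bool"
where
  "irreducible_matrix r P \<longleftrightarrow>
     (\<forall>u\<in>{1..r}. \<forall>v\<in>{1..r}. (u, v) \<in> {(a, b). a \<in> {1..r} \<and> b \<in> {1..r} \<and> P a b > 0}\<^sup>+)"

definition quasi_irreducible ::
  "('a, 'b) monoid_scheme \<Rightarrow> nat \<Rightarrow> ('a \<Rightarrow> nat \<Rightarrow> nat \<Rightarrow> real) \<Rightarrow> bool"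
where
  "quasi_irreducible G r q \<longleftrightarrow>
     generate G (coloured_support G r q) = carrier G \<and> irreducible_matrix r (colour_matrix G q)"

definition invariant_probability :: "nat \<Rightarrow> (nat \<Rightarrow> nat \<Rightarrow> real) \<Rightarrow> (nat \<Rightarrow> real) \<Rightarrow> bool"
where
  "invariant_probability r P \<pi> \<longleftrightarrow>
     (\<forall>u\<in>{1..r}. \<pi> u \<ge> 0) \<and> (\<Sum>u\<in>{1..r}. \<pi> u) = 1 \<and>
     (\<forall>v\<in>{1..r}. (\<Sum>u\<in>{1..r}. \<pi> u * P u v) = \<pi> v)"

text \<open>
  If the colour matrix is irreducible, its invariant probability measure is unique, so the
  existential quantifier denotes \<^emph>\<open>the\<close> invariant measure.
\<close>

definition coloured_reversible ::
  "('a, 'b) monoid_scheme \<Rightarrow> nat \<Rightarrow> ('a \<Rightarrow> nat \<Rightarrow> nat \<Rightarrow> real) \<Rightarrow> bool"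
where
  "coloured_reversible G r q \<longleftrightarrow>
     (\<exists>\<pi>. invariant_probability r (colour_matrix G q) \<pi> \<and>
        (\<forall>g\<in>carrier G. \<forall>u\<in>{1..r}. \<forall>v\<in>{1..r}. \<pi> u * q g u v = \<pi> v * q (inv\<^bsub>G\<^esub> g) v u))"


section \<open>Linearization\<close>

text \<open>
  As the stopping times are only almost surely finite, \<^const>\<open>the_enat\<close> is applied to them below;
  its value at \<open>\<infinity>\<close> matters on a null set only.
\<close>

definition increment :: "(nat \<Rightarrow> 'w \<Rightarrow> enat) \<Rightarrow> nat \<Rightarrow> 'w \<Rightarrow> real"
where
  "increment \<tau> n \<omega> = real (the_enat (\<tau> (Suc n) \<omega>)) - real (the_enat (\<tau> n \<omega>))"

definition renewal_process :: "'w measure \<Rightarrow> (nat \<Rightarrow> 'w \<Rightarrow> enat) \<Rightarrow> bool"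
where
  "renewal_process M \<tau> \<longleftrightarrow>
     (AE \<omega> in M. \<forall>n. \<tau> n \<omega> < \<infinity> \<and> \<tau> n \<omega> < \<tau> (Suc n) \<omega>) \<and>
     prob_space.indep_vars M (\<lambda>_. borel) (increment \<tau>) UNIV \<and>
     (\<forall>n. distr M borel (increment \<tau> n) = distr M borel (increment \<tau> 0)) \<and>
     (\<forall>n. integrable M (increment \<tau> n))"

definition linearizing_times ::
  "('a, 'b) monoid_scheme \<Rightarrow> nat \<Rightarrow> 'a pmf \<Rightarrow> 'w measure \<Rightarrow> (nat \<Rightarrow> 'w \<Rightarrow> 'a \<times> nat) \<Rightarrow>
   (nat \<Rightarrow> 'w \<Rightarrow> enat) \<Rightarrow> bool"
where
  "linearizing_times G r p M Y \<tau> \<longleftrightarrow>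
     (\<forall>n. stopping_time (natural_filtration M (carrier G \<times> {1..r}) Y) (\<tau> n)) \<and>
     (\<forall>\<omega>\<in>space M. \<tau> 0 \<omega> = 0) \<and>
     (AE \<omega> in M. \<forall>n. snd (Y (the_enat (\<tau> n \<omega>)) \<omega>) = 1) \<and>
     markov_chain M (carrier G) (conv_kernel G p) \<one>\<^bsub>G\<^esub> (\<lambda>n \<omega>. fst (Y (the_enat (\<tau> n \<omega>)) \<omega>)) \<and>
     renewal_process M \<tau>"

text \<open>
  The sample spaces range over the type of trajectories, which is large enough to carry the law of
  the chain. Existence of a realization is stated explicitly so that the quantification over all
  realizations cannot be vacuous.
\<close>

definition linearizes ::
  "('a, 'b) monoid_scheme \<Rightarrow> 'a set \<Rightarrow> nat \<Rightarrow> ('a \<Rightarrow> nat \<Rightarrow> nat \<Rightarrow> real) \<Rightarrow> 'a pmf \<Rightarrow> bool"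
where
  "linearizes G S r q p \<longleftrightarrow>
     coloured_walk G r q \<and> quasi_irreducible G r q \<and> nearest_neighbour G S r q \<and>
     (\<exists>(M :: (nat \<Rightarrow> 'a \<times> nat) measure) Y.
        markov_chain M (carrier G \<times> {1..r}) (coloured_kernel G q) (\<one>\<^bsub>G\<^esub>, 1) Y) \<and>
     (\<forall>(M :: (nat \<Rightarrow> 'a \<times> nat) measure) Y.
        markov_chain M (carrier G \<times> {1..r}) (coloured_kernel G q) (\<one>\<^bsub>G\<^esub>, 1) Y \<longrightarrow>
        (\<exists>\<tau>. linearizing_times G r p M Y \<tau>))"

end

(*
  Proof idea. Attach to a root one loop for every g in the support of p, labelled by a word in S that
  represents g. Let the colour walk enter a loop and perform a simple random walk on it until it
  is back at the root. Count only the excursions that leave a loop at the end opposite to the one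
  where they entered: these have increment g or g^-1, all others have increment 1. With entrance
  probabilities proportional to length times p(g), the loop of g is the next one traversed with
  probability p(g), by the gambler's ruin formula. If both ends are entered with equal
  probability, the colour walk is reversible, and the increments have law p exactly when
  p is symmetric; in general only the near end is entered.

  For the renewal structure, a finite automaton cuts the sequence of colours into words of a prefix
  code. The probability of a sequence of code words is the product of their weights, so the
  code words are i.i.d.; a Lyapunov function bounds their mean length, and a bounded harmonic
  function computes the law of their increments.
*)
theory Submission imports Defs
begin

section \<open>Markov chains and i.i.d. sequences\<close>

text \<open>The obstacle is that every realization of the coloured walk must be treated, and a
  realization is known only through conditional probabilities along histories of positive
  probability. Everything is therefore reduced to probabilities of finite colour words. Each ordered
  pair of colours carries a single group label, so the colours almost surely determine the
  positions, and a finite chain remains to be studied. Colours do not show at which side a loop was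
  entered; the automaton supplies this memory. Its final states have the colour of its initial one,
  so weights of concatenated code words multiply, which replaces the strong Markov property; a limit
  over bounded word lengths replaces optional stopping. Let K be the mean loop length under p. An
  excursion traverses the loop of g with probability p(g) / K, hence some loop with probability 1 /
  K, and the discarded excursions do not bias the choice of g. Walking to and fro in a loop, instead
  of running through it in one direction, is what allows detailed balance. A parameter \<beta>, the
  share of far entrances, lets one construction serve both claims.\<close>

lemma (in prob_space) indep_vars_iidI:
  fixes X :: "nat \<Rightarrow> 'a \<Rightarrow> 'b"
  assumes rv [measurable]: "\<And>i. random_variable N (X i)"
    and iid: "\<And>n A. (\<And>i. A i \<in> sets N) \<Longrightarrow>
      \<P>(\<omega> in M. \<forall>i<n. X i \<omega> \<in> A i) = (\<Prod>i<n. \<P>(\<omega> in M. X 0 \<omega> \<in> A i))"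
  shows "indep_vars (\<lambda>_. N) X UNIV" "distr M N (X i) = distr M N (X 0)"
proof -
  have sub: "\<P>(\<omega> in M. \<forall>i\<in>J. X i \<omega> \<in> A i) = (\<Prod>i\<in>J. \<P>(\<omega> in M. X 0 \<omega> \<in> A i))"
    if J: "finite J" and A: "\<And>i. i \<in> J \<Longrightarrow> A i \<in> sets N" for J A
  proof -
    obtain n where n: "J \<subseteq> {..<n}"
      using J finite_nat_iff_bounded by auto
    \<comment> \<open>Positions outside \<open>J\<close> are padded with the whole space, whose
      factor is 1, so that initial segments suffice.\<close>
    define B where "B i = (if i \<in> J then A i else space N)" for i
    have "\<P>(\<omega> in M. \<forall>i\<in>J. X i \<omega> \<in> A i) = \<P>(\<omega> in M. \<forall>i<n. X i \<omega> \<in> B i)"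
      using n by (intro arg_cong[where f=prob] Collect_cong)
        (auto simp: B_def intro: measurable_space[OF rv])
    also have "\<dots> = (\<Prod>i<n. \<P>(\<omega> in M. X 0 \<omega> \<in> B i))"
      by (rule iid) (auto simp: B_def A)
    also have "\<dots> = (\<Prod>i\<in>J. \<P>(\<omega> in M. X 0 \<omega> \<in> B i))"
    proof (rule prod.mono_neutral_right)
      show "\<forall>i\<in>{..<n} - J. \<P>(\<omega> in M. X 0 \<omega> \<in> B i) = 1"
      proof
        fix i assume "i \<in> {..<n} - J"
        then have "{\<omega> \<in> space M. X 0 \<omega> \<in> B i} = space M"
          by (auto simp: B_def intro: measurable_space[OF rv])
        then show "\<P>(\<omega> in M. X 0 \<omega> \<in> B i) = 1"
          by (simp add: prob_space)
      qed
    qed (use n in auto)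
    also have "\<dots> = (\<Prod>i\<in>J. \<P>(\<omega> in M. X 0 \<omega> \<in> A i))"
      by (auto simp: B_def)
    finally show ?thesis .
  qed
  have one: "\<P>(\<omega> in M. X i \<omega> \<in> A) = \<P>(\<omega> in M. X 0 \<omega> \<in> A)" if "A \<in> sets N" for i A
    using sub[of "{i}" "\<lambda>_. A"] that by simp
  show "distr M N (X i) = distr M N (X 0)"
  proof (rule measure_eqI)
    fix A assume "A \<in> sets (distr M N (X i))"
    then have A: "A \<in> sets N" by simp
    have "X j -` A \<inter> space M = {\<omega> \<in> space M. X j \<omega> \<in> A}" for j
      by auto
    then show "emeasure (distr M N (X i)) A = emeasure (distr M N (X 0)) A"
      using one[OF A, of i] A by (simp add: emeasure_distr emeasure_eq_measure)
  qed simp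
  show "indep_vars (\<lambda>_. N) X UNIV"
    unfolding indep_vars_def2
  proof (intro conjI ballI indep_setsI)
    fix A J assume J: "J \<noteq> {}" "finite (J::nat set)"
      and A: "\<forall>j\<in>J. A j \<in> {X j -` B \<inter> space M |B. B \<in> sets N}"
    from A have "\<forall>j\<in>J. \<exists>B. A j = X j -` B \<inter> space M \<and> B \<in> sets N"
      by auto
    from bchoice[OF this] obtain B where
      B: "\<And>j. j \<in> J \<Longrightarrow> A j = X j -` B j \<inter> space M" "\<And>j. j \<in> J \<Longrightarrow> B j \<in> sets N"
      by blast
    have AB: "A j = {\<omega>\<in>space M. X j \<omega> \<in> B j}" if "j \<in> J" for j
      using B(1)[OF that] by auto
    have "(\<Inter>j\<in>J. A j) = {\<omega>\<in>space M. \<forall>j\<in>J. X j \<omega> \<in> B j}"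
      using J AB by auto
    then have "prob (\<Inter>j\<in>J. A j) = (\<Prod>j\<in>J. \<P>(\<omega> in M. X 0 \<omega> \<in> B j))"
      using sub[of J B] J B by simp
    also have "\<dots> = (\<Prod>j\<in>J. prob (A j))"
    proof (rule prod.cong)
      fix j assume j: "j \<in> J"
      show "\<P>(\<omega> in M. X 0 \<omega> \<in> B j) = prob (A j)"
        unfolding AB[OF j] by (rule one[OF B(2)[OF j], symmetric])
    qed simp
    finally show "prob (\<Inter>j\<in>J. A j) = (\<Prod>j\<in>J. prob (A j))" .
  qed (use rv in auto)
qed

text \<open>Points are exchanged for sets one coordinate at a time; each exchange is a countable sum
  over the values of that coordinate. In \<open>?B\<close> the first \<open>m\<close> coordinates
  already carry sets.\<close>

lemma (in prob_space) iid_eventsI_countable: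
  fixes X :: "nat \<Rightarrow> 'a \<Rightarrow> 'b :: countable"
  assumes rv [measurable]: "\<And>i. random_variable (count_space UNIV) (X i)"
    and iid: "\<And>n x. \<P>(\<omega> in M. \<forall>i<n. X i \<omega> = x i) = (\<Prod>i<n. \<P>(\<omega> in M. X 0 \<omega> = x i))"
  shows "\<P>(\<omega> in M. \<forall>i<n. X i \<omega> \<in> A i) = (\<Prod>i<n. \<P>(\<omega> in M. X 0 \<omega> \<in> A i))"
proof -
  let ?B = "\<lambda>m x i. if i < m then A i else {x i}"
  have "\<P>(\<omega> in M. \<forall>i<n. X i \<omega> \<in> ?B m x i) = (\<Prod>i<n. \<P>(\<omega> in M. X 0 \<omega> \<in> ?B m x i))" if "m \<le> n" for m x
    using that
  proof (induction m arbitrary: x)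
    case 0
    then show ?case using iid[of n x] by simp
  next
    case (Suc m)
    let ?E = "\<lambda>a. {\<omega>\<in>space M. \<forall>i<n. X i \<omega> \<in> ?B m (x(m := a)) i}"
    let ?c = "\<Prod>i\<in>{..<n} - {m}. \<P>(\<omega> in M. X 0 \<omega> \<in> ?B (Suc m) x i)"
    have c0: "?c \<ge> 0"
      by (intro prod_nonneg) auto
    have E: "prob (?E a) = ?c * \<P>(\<omega> in M. X 0 \<omega> = a)" for a
    proof -
      have "prob (?E a) = (\<Prod>i<n. \<P>(\<omega> in M. X 0 \<omega> \<in> ?B m (x(m := a)) i))"
        using Suc by simp
      also have "\<dots> = \<P>(\<omega> in M. X 0 \<omega> \<in> ?B m (x(m := a)) m) *
          (\<Prod>i\<in>{..<n} - {m}. \<P>(\<omega> in M. X 0 \<omega> \<in> ?B m (x(m := a)) i))"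
        using Suc by (subst prod.remove[of _ m]) auto
      also have "(\<Prod>i\<in>{..<n} - {m}. \<P>(\<omega> in M. X 0 \<omega> \<in> ?B m (x(m := a)) i)) = ?c"
        by (intro prod.cong) auto
      finally show ?thesis by simp
    qed
    have "emeasure M {\<omega>\<in>space M. \<forall>i<n. X i \<omega> \<in> ?B (Suc m) x i} = emeasure M (\<Union>a\<in>A m. ?E a)"
      using Suc.prems by (intro arg_cong[where f="emeasure M"]) (auto split: if_splits simp: less_Suc_eq)
    also have "\<dots> = (\<integral>\<^sup>+a. emeasure M (?E a) \<partial>count_space (A m))"
      using Suc.prems by (intro emeasure_UN_countable)
        (auto simp: disjoint_family_on_def dest!: spec[of _ m])
    also have "\<dots> = (\<integral>\<^sup>+a. ennreal ?c * emeasure M {\<omega>\<in>space M. X 0 \<omega> = a} \<partial>count_space (A m))"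
      using c0 by (simp add: emeasure_eq_measure E ennreal_mult)
    also have "\<dots> = ennreal ?c * (\<integral>\<^sup>+a. emeasure M {\<omega>\<in>space M. X 0 \<omega> = a} \<partial>count_space (A m))"
      by (rule nn_integral_cmult) auto
    also have "(\<integral>\<^sup>+a. emeasure M {\<omega>\<in>space M. X 0 \<omega> = a} \<partial>count_space (A m)) =
        emeasure M (\<Union>a\<in>A m. {\<omega>\<in>space M. X 0 \<omega> = a})"
      by (intro emeasure_UN_countable[symmetric]) (auto simp: disjoint_family_on_def)
    also have "(\<Union>a\<in>A m. {\<omega>\<in>space M. X 0 \<omega> = a}) = {\<omega>\<in>space M. X 0 \<omega> \<in> A m}"
      by auto
    finally have "\<P>(\<omega> in M. \<forall>i<n. X i \<omega> \<in> ?B (Suc m) x i) = ?c * \<P>(\<omega> in M. X 0 \<omega> \<in> A m)"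
      using c0 unfolding emeasure_eq_measure
      by (subst (asm) ennreal_mult[symmetric]; (subst (asm) ennreal_inj)?) simp_all
    also have "\<dots> = (\<Prod>i<n. \<P>(\<omega> in M. X 0 \<omega> \<in> ?B (Suc m) x i))"
      using Suc.prems by (subst (2) prod.remove[of _ m]) auto
    finally show ?case .
  qed
  from this[of n undefined] show ?thesis
    by (simp cong: conj_cong)
qed

text \<open>The definition is silent about transitions out of null histories, so the induction
  splits there: extensions of a null history are null, and the right-hand side has already
  vanished.\<close>

lemma markov_chain_path_prob:
  assumes mc: "markov_chain M E K x0 X" and x: "\<And>i. i \<le> n \<Longrightarrow> x i \<in> E"
  shows "\<P>(\<omega> in M. \<forall>i\<le>n. X i \<omega> = x i) = (if x 0 = x0 then \<Prod>i<n. K (x i) (x (Suc i)) else 0)"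
proof -
  interpret prob_space M using mc by (simp add: markov_chain_def)
  have meas[measurable]: "X i \<in> M \<rightarrow>\<^sub>M count_space E" for i
    using mc by (simp add: markov_chain_def)
  have ev: "{\<omega>\<in>space M. X i \<omega> = y} \<in> events" if "y \<in> E" for i y
  proof -
    have "X i -` {y} \<inter> space M = {\<omega>\<in>space M. X i \<omega> = y}" by auto
    with measurable_sets[OF meas, of "{y}" i] that show ?thesis by simp
  qed
  show ?thesis
    using x
  proof (induction n)
    case 0
    have ae: "AE \<omega> in M. X 0 \<omega> = x0"
      using mc by (simp add: markov_chain_def)
    have "\<P>(\<omega> in M. X 0 \<omega> = x 0) = (if x 0 = x0 then 1 else 0)"
    proof (cases "x 0 = x0")
      case True
      have "{\<omega>\<in>space M. X 0 \<omega> = x 0} \<in> events" using ev 0 by simp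
      with True ae show ?thesis
        by (simp add: prob_Collect_eq_1)
    next
      case False
      have "{\<omega>\<in>space M. X 0 \<omega> = x 0} \<in> events" using ev 0 by simp
      moreover from ae have "AE \<omega> in M. \<not> X 0 \<omega> = x 0" by eventually_elim (use False in auto)
      ultimately show ?thesis using False
        by (simp add: prob_Collect_eq_0)
    qed
    then show ?case by (simp only: le_zero_eq simp_thms lessThan_0 prod.empty)
  next
    case (Suc n)
    let ?Q = "\<lambda>n. {\<omega>\<in>space M. \<forall>i\<le>n. X i \<omega> = x i}"
    have Qev: "?Q m \<in> events" if "m \<le> Suc n" for m
    proof -
      have "{\<omega>\<in>space M. \<forall>i\<in>{..m}. X i \<omega> = x i} \<in> events"
        by (rule sets.sets_Collect_finite_All') (use that in \<open>auto intro!: ev Suc.prems\<close>)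
      then show ?thesis by simp
    qed
    have IH: "prob (?Q n) = (if x 0 = x0 then \<Prod>i<n. K (x i) (x (Suc i)) else 0)"
      using Suc by simp
    have Q: "?Q (Suc n) = {\<omega>\<in>space M. X (Suc n) \<omega> = x (Suc n) \<and> (\<forall>i\<le>n. X i \<omega> = x i)}"
      by (auto simp: le_Suc_eq)
    show ?case
    proof (cases "prob (?Q n) > 0")
      case True
      have "\<P>(\<omega> in M. X (Suc n) \<omega> = x (Suc n) \<bar> \<forall>i\<le>n. X i \<omega> = x i) = K (x n) (x (Suc n))"
      proof -
        have "\<forall>n x y. (\<forall>i\<le>n. x i \<in> E) \<longrightarrow> y \<in> E \<longrightarrow> \<P>(\<omega> in M. \<forall>i\<le>n. X i \<omega> = x i) > 0 \<longrightarrow>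
            \<P>(\<omega> in M. X (Suc n) \<omega> = y \<bar> \<forall>i\<le>n. X i \<omega> = x i) = K (x n) y"
          using mc by (simp add: markov_chain_def)
        from this[rule_format, of n x "x (Suc n)"] show ?thesis
          using Suc.prems True by simp
      qed
      then have "prob (?Q (Suc n)) = prob (?Q n) * K (x n) (x (Suc n))"
        using True unfolding cond_prob_def Q by (simp add: field_simps)
      then show ?thesis
        unfolding IH by (simp split: if_splits)
    next
      case False
      then have 0: "prob (?Q n) = 0"
        using measure_nonneg[of M "?Q n"] by linarith
      have "prob (?Q (Suc n)) \<le> prob (?Q n)"
        by (rule finite_measure_mono) (use Qev in auto)
      then have "prob (?Q (Suc n)) = 0"
        using 0 measure_nonneg[of M "?Q (Suc n)"] by linarith
      moreover have "(if x 0 = x0 then \<Prod>i<Suc n. K (x i) (x (Suc i)) else 0) = 0"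
        using 0 unfolding IH by (simp split: if_splits)
      ultimately show ?thesis by simp
    qed
  qed
qed

text \<open>A forbidden step shows in a finite prefix of the trajectory. Prefixes are coded as lists
  over \<open>E\<close>, of which there are countably many, so the null events can be
  united.\<close>

lemma markov_chain_AE_steps:
  assumes mc: "markov_chain M E K x0 X" and E: "countable E"
  shows "AE \<omega> in M. \<forall>n. K (X n \<omega>) (X (Suc n) \<omega>) \<noteq> 0"
proof -
  interpret prob_space M using mc by (simp add: markov_chain_def)
  have meas[measurable]: "X i \<in> M \<rightarrow>\<^sub>M count_space E" for i
    using mc by (simp add: markov_chain_def)
  have ev: "{\<omega>\<in>space M. X i \<omega> = y} \<in> events" if "y \<in> E" for i y
  proof -
    have "X i -` {y} \<inter> space M = {\<omega>\<in>space M. X i \<omega> = y}" by auto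
    with measurable_sets[OF meas, of "{y}" i] that show ?thesis by simp
  qed
  have "AE \<omega> in M. \<forall>xs\<in>lists E. \<forall>n. length xs = n + 2 \<longrightarrow> K (xs ! n) (xs ! Suc n) = 0 \<longrightarrow>
      \<not> (\<forall>i\<le>Suc n. X i \<omega> = xs ! i)"
    unfolding AE_ball_countable[OF countable_lists[OF E]] AE_all_countable
  proof (intro ballI allI)
    fix xs :: "'b list" and n assume xs: "xs \<in> lists E"
    show "AE \<omega> in M. length xs = n + 2 \<longrightarrow> K (xs ! n) (xs ! Suc n) = 0 \<longrightarrow>
      \<not> (\<forall>i\<le>Suc n. X i \<omega> = xs ! i)"
    proof (cases "length xs = n + 2 \<and> K (xs ! n) (xs ! Suc n) = 0")
      case True
      then have inE: "xs ! i \<in> E" if "i \<le> Suc n" for i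
        using xs that by (auto simp: in_lists_conv_set)
      then have "\<P>(\<omega> in M. \<forall>i\<le>Suc n. X i \<omega> = xs ! i) = 0"
        using True by (subst markov_chain_path_prob[OF mc]) auto
      moreover have "{\<omega>\<in>space M. \<forall>i\<le>Suc n. X i \<omega> = xs ! i} \<in> events"
      proof -
        have "{\<omega>\<in>space M. \<forall>i\<in>{..Suc n}. X i \<omega> = xs ! i} \<in> events"
          by (rule sets.sets_Collect_finite_All') (auto intro!: ev inE)
        then show ?thesis by simp
      qed
      ultimately show ?thesis
        by (subst (asm) prob_Collect_eq_0) auto
    qed auto
  qed
  with AE_space show ?thesis
  proof eventually_elim
    case (elim \<omega>)
    show ?case
    proof
      fix n
      let ?xs = "map (\<lambda>i. X i \<omega>) [0..<n+2]"
      have *: "?xs ! i = X i \<omega>" if "i \<le> Suc n" for i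
        using that by (subst nth_map) (auto simp del: upt_Suc)
      have "?xs \<in> lists E"
        using elim(1) measurable_space[OF meas] by auto
      with elim(2) have "length ?xs = n + 2 \<longrightarrow> K (?xs ! n) (?xs ! Suc n) = 0 \<longrightarrow>
        \<not> (\<forall>i\<le>Suc n. X i \<omega> = ?xs ! i)" by blast
      then show "K (X n \<omega>) (X (Suc n) \<omega>) \<noteq> 0"
        using * by auto
    qed
  qed
qed

text \<open>The quotient of two path products that differ by one factor is that factor. In this form
  the Markov property is checked for the constructed chain and for the embedded walk.\<close>

lemma markov_chainI_path_prob:
  assumes M: "prob_space M" and X: "\<And>n. X n \<in> M \<rightarrow>\<^sub>M count_space E"
    and x0: "AE \<omega> in M. X 0 \<omega> = x0"
    and path: "\<And>n x. (\<And>i. i \<le> n \<Longrightarrow> x i \<in> E) \<Longrightarrow> \<P>(\<omega> in M. \<forall>i\<le>n. X i \<omega> = x i) =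
      (if x 0 = x0 then \<Prod>i<n. K (x i) (x (Suc i)) else 0)"
  shows "markov_chain M E K x0 X"
  unfolding markov_chain_def
proof (intro conjI allI impI M X x0)
  fix n x y
  assume x: "\<forall>i\<le>n. x i \<in> E" and y: "y \<in> E"
    and pos: "\<P>(\<omega> in M. \<forall>i\<le>n. X i \<omega> = x i) > 0"
  let ?p = "\<Prod>i<n. K (x i) (x (Suc i))"
  have 1: "\<P>(\<omega> in M. \<forall>i\<le>n. X i \<omega> = x i) = ?p" and "x 0 = x0"
    using pos path[of n x] x by (auto split: if_splits)
  let ?x = "x(Suc n := y)"
  have "\<P>(\<omega> in M. \<forall>i\<le>Suc n. X i \<omega> = ?x i) = (\<Prod>i<Suc n. K (?x i) (?x (Suc i)))"
    using path[of "Suc n" ?x] x y \<open>x 0 = x0\<close> by simp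
  also have "\<dots> = ?p * K (x n) y"
    by simp
  also have "{\<omega>\<in>space M. \<forall>i\<le>Suc n. X i \<omega> = ?x i} =
      {\<omega>\<in>space M. X (Suc n) \<omega> = y \<and> (\<forall>i\<le>n. X i \<omega> = x i)}"
    by (auto simp: le_Suc_eq)
  finally show "\<P>(\<omega> in M. X (Suc n) \<omega> = y \<bar> \<forall>i\<le>n. X i \<omega> = x i) = K (x n) y"
    using pos unfolding cond_prob_def 1
    by (metis nonzero_mult_div_cancel_left order_less_irrefl)
qed

text \<open>Random mapping representation: independent maps drawn from \<open>R\<close> are applied
  in turn. Each step of a path uses a fresh map, so only the law of the image of a single point
  matters.\<close>

lemma markov_chain_random_maps:
  fixes R :: "'f pmf" and f :: "'f \<Rightarrow> 's \<Rightarrow> 's"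
  assumes E: "countable E" "x0 \<in> E" and f: "\<And>a x. x \<in> E \<Longrightarrow> f a x \<in> E"
    and K: "\<And>x y. x \<in> E \<Longrightarrow> y \<in> E \<Longrightarrow> measure_pmf.prob R {a. f a x = y} = K x y"
  shows "\<exists>(M :: (nat \<Rightarrow> 's) measure) X. markov_chain M E K x0 X"
proof -
  define N where "N = PiM UNIV (\<lambda>_::nat. measure_pmf R)"
  interpret N: product_prob_space "\<lambda>_::nat. measure_pmf R" UNIV ..
  define Y where "Y \<omega> n = rec_nat x0 (\<lambda>i x. f (\<omega> i) x) n" for \<omega> :: "nat \<Rightarrow> 'f" and n
  have Y_simps: "Y \<omega> 0 = x0" "Y \<omega> (Suc n) = f (\<omega> n) (Y \<omega> n)" for \<omega> n
    by (simp_all add: Y_def)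
  have Y_mem: "Y \<omega> n \<in> E" for \<omega> n
    by (induction n) (simp_all add: Y_simps E f)
  have Y_meas: "(\<lambda>\<omega>. Y \<omega> n) \<in> N \<rightarrow>\<^sub>M count_space E" for n
  proof (induction n)
    case 0
    then show ?case using E by (simp add: Y_simps)
  next
    case (Suc n)
    show ?case
      unfolding Y_simps
    proof (rule measurable_compose_countable'[OF _ Suc E(1)])
      fix x assume "x \<in> E"
      then have "(\<lambda>a. f a x) \<in> measure_pmf R \<rightarrow>\<^sub>M count_space E"
        using f by simp
      moreover have "(\<lambda>\<omega>. \<omega> n) \<in> N \<rightarrow>\<^sub>M measure_pmf R"
        unfolding N_def by (rule measurable_component_singleton) simp
      ultimately show "(\<lambda>\<omega>. f (\<omega> n) x) \<in> N \<rightarrow>\<^sub>M count_space E"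
        by (rule measurable_compose[rotated])
    qed
  qed
  let ?S = "PiM UNIV (\<lambda>_::nat. count_space E)"
  \<comment> \<open>The law is moved to trajectory space because \<open>linearizes\<close>
    prescribes the type of the sample space.\<close>
  define M where "M = distr N ?S Y"
  have Y_S: "Y \<in> N \<rightarrow>\<^sub>M ?S"
    by (rule measurable_PiM_single') (use Y_meas Y_mem in auto)
  have comp: "(\<lambda>\<omega>. \<omega> n) \<in> M \<rightarrow>\<^sub>M count_space E" for n
    unfolding M_def by simp
  have pN: "prob_space N"
    unfolding N_def by (rule N.P.prob_space_axioms)
  have "markov_chain M E K x0 (\<lambda>n \<omega>. \<omega> n)"
  proof (rule markov_chainI_path_prob[OF _ comp])
    show pM: "prob_space M"
      unfolding M_def by (rule prob_space.prob_space_distr[OF pN Y_S])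
    have single: "{\<omega>\<in>space M. \<omega> i = y} \<in> sets M" if "y \<in> E" for i y
    proof -
      have "(\<lambda>\<omega>. \<omega> i) -` {y} \<inter> space M = {\<omega>\<in>space M. \<omega> i = y}" by auto
      with measurable_sets[OF comp, of "{y}" i] that show ?thesis by simp
    qed
    have "{\<omega>\<in>space ?S. \<omega> 0 = x0} \<in> sets ?S"
      using single[OF E(2), of 0] by (simp add: M_def)
    then show "AE \<omega> in M. \<omega> 0 = x0"
      unfolding M_def by (subst AE_distr_iff[OF Y_S]) (simp_all add: Y_simps)
    fix n and x :: "nat \<Rightarrow> 's" assume x: "\<And>i. i \<le> n \<Longrightarrow> x i \<in> E"
    have "{\<omega>\<in>space M. \<forall>i\<in>{..n}. \<omega> i = x i} \<in> sets M"
      by (rule sets.sets_Collect_finite_All') (auto intro!: single x)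
    then have "measure M {\<omega>\<in>space M. \<forall>i\<le>n. \<omega> i = x i} =
        measure N (Y -` {\<omega>\<in>space M. \<forall>i\<le>n. \<omega> i = x i} \<inter> space N)"
      unfolding M_def by (subst measure_distr[OF Y_S]) simp_all
    also have "Y -` {\<omega>\<in>space M. \<forall>i\<le>n. \<omega> i = x i} \<inter> space N = {\<omega>\<in>space N. \<forall>i\<le>n. Y \<omega> i = x i}"
      using measurable_space[OF Y_S] by (auto simp: M_def)
    also have "\<dots> = (if x 0 = x0 then
        {\<omega>\<in>space N. \<forall>i\<in>{..<n}. \<omega> i \<in> {a. f a (x i) = x (Suc i)}} else {})"
    proof -
      have "(\<forall>i\<le>n. Y \<omega> i = x i) \<longleftrightarrow> x 0 = x0 \<and> (\<forall>i<n. f (\<omega> i) (x i) = x (Suc i))" for \<omega>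
      proof (induction n)
        case 0
        then show ?case by (auto simp: Y_simps)
      next
        case (Suc n)
        have "(\<forall>i\<le>Suc n. Y \<omega> i = x i) \<longleftrightarrow> (\<forall>i\<le>n. Y \<omega> i = x i) \<and> f (\<omega> n) (x n) = x (Suc n)"
          by (metis le_Suc_eq order_refl Y_simps(2))
        then show ?case unfolding Suc.IH by (auto simp: less_Suc_eq)
      qed
      then show ?thesis by auto
    qed
    also have "measure N \<dots> = (if x 0 = x0 then \<Prod>i<n. K (x i) (x (Suc i)) else 0)"
    proof -
      have "measure N {\<omega>\<in>space N. \<forall>i\<in>{..<n}. \<omega> i \<in> {a. f a (x i) = x (Suc i)}} =
          (\<Prod>i<n. measure_pmf.prob R {a. f a (x i) = x (Suc i)})"
        unfolding N_def measure_def by (subst N.emeasure_PiM_Collect)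
          (simp_all add: measure_pmf.emeasure_eq_measure prod_ennreal prod_nonneg)
      also have "\<dots> = (\<Prod>i<n. K (x i) (x (Suc i)))"
        by (rule prod.cong) (use x in \<open>auto intro!: K\<close>)
      finally show ?thesis by simp
    qed
    finally show "measure M {\<omega>\<in>space M. \<forall>i\<le>n. \<omega> i = x i} =
      (if x 0 = x0 then \<Prod>i<n. K (x i) (x (Suc i)) else 0)" .
  qed
  then show ?thesis by blast
qed

lemma pmf_of_weights:
  fixes w :: "'c \<Rightarrow> real"
  assumes "finite C" "\<And>c. c \<in> C \<Longrightarrow> w c \<ge> 0" "(\<Sum>c\<in>C. w c) = 1"
  obtains R where "\<And>c. pmf R c = (if c \<in> C then w c else 0)"
proof
  fix c
  show "pmf (embed_pmf (\<lambda>c. if c \<in> C then w c else 0)) c = (if c \<in> C then w c else 0)"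
  proof (rule pmf_embed_pmf)
    have "(\<integral>\<^sup>+c. ennreal (if c \<in> C then w c else 0) \<partial>count_space UNIV) =
        (\<integral>\<^sup>+c. ennreal (w c) * indicator C c \<partial>count_space UNIV)"
      by (intro nn_integral_cong) auto
    also have "\<dots> = (\<Sum>c\<in>C. ennreal (w c))"
      using assms(1) by (simp add: nn_integral_count_space_indicator[symmetric] nn_integral_count_space_finite)
    also have "\<dots> = 1"
      using assms by (simp add: sum_ennreal)
    finally show "(\<integral>\<^sup>+c. ennreal (if c \<in> C then w c else 0) \<partial>count_space UNIV) = 1" .
  qed (use assms in auto)
qed

context group
begin

abbreviation list_mult :: "'a list \<Rightarrow> 'a" where
  "list_mult xs \<equiv> foldr (\<otimes>) xs \<one>"

lemma list_mult_closed: "set xs \<subseteq> carrier G \<Longrightarrow> list_mult xs \<in> carrier G"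
  by (induction xs) auto

lemma list_mult_append:
  "set xs \<subseteq> carrier G \<Longrightarrow> set ys \<subseteq> carrier G \<Longrightarrow> list_mult (xs @ ys) = list_mult xs \<otimes> list_mult ys"
proof (induction xs)
  case (Cons x xs)
  then show ?case
    using list_mult_closed[of xs] list_mult_closed[of ys] by (simp add: m_assoc)
qed (simp add: list_mult_closed)

text \<open>Serves two purposes: a finitely generated group is countable, and every group element
  has a word from which its loop is built.\<close>

lemma generate_eq_list_mult:
  assumes "S \<subseteq> carrier G"
  shows "generate G S = list_mult ` lists (S \<union> m_inv G ` S)"
proof (intro subset_antisym subsetI)
  have S: "S \<union> m_inv G ` S \<subseteq> carrier G" using assms by auto
  fix g assume "g \<in> generate G S"
  then show "g \<in> list_mult ` lists (S \<union> m_inv G ` S)"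
  proof induction
    case one
    show ?case by (rule image_eqI[of _ _ "[]"]) auto
  next
    case (incl h)
    then show ?case using assms by (intro image_eqI[of _ _ "[h]"]) auto
  next
    case (inv h)
    then show ?case using assms by (intro image_eqI[of _ _ "[inv h]"]) auto
  next
    case (eng g h)
    then obtain xs ys where "xs \<in> lists (S \<union> m_inv G ` S)" "g = list_mult xs"
      "ys \<in> lists (S \<union> m_inv G ` S)" "h = list_mult ys" by auto
    moreover from this have "set xs \<subseteq> carrier G" "set ys \<subseteq> carrier G"
      using S by (auto simp: in_lists_conv_set)
    ultimately show ?case
      by (intro image_eqI[of _ _ "xs @ ys"]) (auto simp: list_mult_append simp del: foldr_append)
  qed
next
  fix g assume "g \<in> list_mult ` lists (S \<union> m_inv G ` S)"
  then obtain xs where "xs \<in> lists (S \<union> m_inv G ` S)" "g = list_mult xs" by auto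
  then show "g \<in> generate G S"
    by (induction xs arbitrary: g) (auto intro: generate.intros)
qed

lemma countable_generate: "countable S \<Longrightarrow> S \<subseteq> carrier G \<Longrightarrow> countable (generate G S)"
  by (simp add: generate_eq_list_mult)

end

section \<open>Words accepted by an automaton along a Markov chain\<close>

primrec path_weight :: "('c \<Rightarrow> 'c \<Rightarrow> real) \<Rightarrow> 'c \<Rightarrow> 'c list \<Rightarrow> real" where
  "path_weight P u [] = 1"
| "path_weight P u (c # cs) = P u c * path_weight P c cs"

lemma path_weight_append:
  "path_weight P u (xs @ ys) = path_weight P u xs * path_weight P (last (u # xs)) ys"
  by (induction xs arbitrary: u) auto

lemma path_weight_conv_prod:
  "path_weight P u xs = (\<Prod>i<length xs. P ((u # xs) ! i) (xs ! i))"
  by (induction xs arbitrary: u) (simp_all add: prod.lessThan_Suc_shift del: prod.lessThan_Suc)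

text \<open>
  A finite automaton reads the colours visited by a Markov chain with transition matrix \<open>P\<close>; the
  states in \<open>F\<close> are final. The drift condition on \<open>L\<close> makes the reading time integrable.
\<close>

locale absorbed_walk =
  fixes r :: nat and P :: "nat \<Rightarrow> nat \<Rightarrow> real" and Z F :: "'z set"
    and \<delta> :: "'z \<Rightarrow> nat \<Rightarrow> 'z" and col :: "'z \<Rightarrow> nat" and L :: "'z \<Rightarrow> real"
  assumes P_nonneg: "\<lbrakk>u \<in> {1..r}; v \<in> {1..r}\<rbrakk> \<Longrightarrow> P u v \<ge> 0"
    and P_sum: "u \<in> {1..r} \<Longrightarrow> (\<Sum>v\<in>{1..r}. P u v) = 1"
    and col_mem: "z \<in> Z \<Longrightarrow> col z \<in> {1..r}"
    and step_mem: "\<lbrakk>z \<in> Z - F; c \<in> {1..r}\<rbrakk> \<Longrightarrow> \<delta> z c \<in> Z"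
    and col_step: "\<lbrakk>z \<in> Z - F; c \<in> {1..r}\<rbrakk> \<Longrightarrow> col (\<delta> z c) = c"
    and L_nonneg: "z \<in> Z \<Longrightarrow> L z \<ge> 0"
    and L_drift: "z \<in> Z - F \<Longrightarrow> 1 + (\<Sum>c\<in>{1..r}. P (col z) c * L (\<delta> z c)) \<le> L z"
begin

abbreviation run :: "'z \<Rightarrow> nat list \<Rightarrow> 'z" where
  "run \<equiv> foldl \<delta>"

text \<open>\<open>accepts z w\<close>: reading \<open>w\<close> from \<open>z\<close>, the end of \<open>w\<close> is the first time a final state is met.\<close>

primrec accepts :: "'z \<Rightarrow> nat list \<Rightarrow> bool" where
  "accepts z [] \<longleftrightarrow> z \<in> F"
| "accepts z (c # cs) \<longleftrightarrow> z \<notin> F \<and> c \<in> {1..r} \<and> accepts (\<delta> z c) cs"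

lemma accepts_prefix_free: "accepts z v \<Longrightarrow> accepts z (v @ w) \<Longrightarrow> w = []"
  by (induction v arbitrary: z) (auto, metis accepts.simps(2) neq_Nil_conv)

lemma accepts_final: "z \<in> F \<Longrightarrow> accepts z w \<longleftrightarrow> w = []"
  by (cases w) auto

lemma set_accepts: "accepts z w \<Longrightarrow> set w \<subseteq> {1..r}"
  by (induction w arbitrary: z) auto

lemma run_mem: "accepts z w \<Longrightarrow> z \<in> Z \<Longrightarrow> run z w \<in> Z \<inter> F"
  by (induction w arbitrary: z) (auto simp: step_mem)

lemma last_run: "accepts z w \<Longrightarrow> z \<in> Z \<Longrightarrow> last (col z # w) = col (run z w)"
proof (induction w arbitrary: z)
  case (Cons c w)
  then show ?case using Cons.IH[of "\<delta> z c"] by (auto simp: step_mem col_step)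
qed auto

lemma path_weight_nonneg: "set w \<subseteq> {1..r} \<Longrightarrow> u \<in> {1..r} \<Longrightarrow> path_weight P u w \<ge> 0"
  by (induction w arbitrary: u) (auto intro!: mult_nonneg_nonneg P_nonneg)

definition accepted :: "nat \<Rightarrow> 'z \<Rightarrow> nat list set" where
  "accepted m z = {w. accepts z w \<and> length w \<le> m}"

text \<open>The mean of \<open>f\<close> at the final state, restricted to reading times at most
  \<open>m\<close>. Being a finite sum over words, it refers to no realization of the chain. With
  \<open>f\<close> constantly 1 it is the distribution function of the reading time.\<close>

definition mass :: "('z \<Rightarrow> real) \<Rightarrow> nat \<Rightarrow> 'z \<Rightarrow> real" where
  "mass f m z = (\<Sum>w\<in>accepted m z. path_weight P (col z) w * f (run z w))"

lemma finite_accepted: "finite (accepted m z)"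
  by (rule finite_subset[OF _ finite_lists_length_le[of "{1..r}" m]])
    (auto simp: accepted_def dest!: set_accepts)

lemma mass_final: "z \<in> F \<Longrightarrow> mass f m z = f z"
proof -
  assume "z \<in> F"
  then have "accepted m z = {[]}" by (auto simp: accepted_def accepts_final)
  then show ?thesis by (simp add: mass_def)
qed

lemma mass_0: "z \<notin> F \<Longrightarrow> mass f 0 z = 0"
proof -
  assume "z \<notin> F"
  then have "accepted 0 z = {}" by (auto simp: accepted_def)
  then show ?thesis by (simp add: mass_def)
qed

lemma mass_Suc:
  assumes z: "z \<in> Z - F"
  shows "mass f (Suc m) z = (\<Sum>c\<in>{1..r}. P (col z) c * mass f m (\<delta> z c))"
proof -
  have eq: "accepted (Suc m) z = (\<Union>c\<in>{1..r}. (#) c ` accepted m (\<delta> z c))" 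
  proof -
    have "w \<in> accepted (Suc m) z \<longleftrightarrow> w \<in> (\<Union>c\<in>{1..r}. (#) c ` accepted m (\<delta> z c))" for w
      using z by (cases w) (auto simp: accepted_def)
    then show ?thesis by blast
  qed
  have "mass f (Suc m) z =
      (\<Sum>c\<in>{1..r}. \<Sum>w\<in>(#) c ` accepted m (\<delta> z c). path_weight P (col z) w * f (run z w))"
    unfolding mass_def eq by (rule sum.UNION_disjoint) (auto simp: finite_accepted)
  also have "\<dots> = (\<Sum>c\<in>{1..r}. P (col z) c * mass f m (\<delta> z c))"
  proof (rule sum.cong)
    fix c assume c: "c \<in> {1..r}"
    show "(\<Sum>w\<in>(#) c ` accepted m (\<delta> z c). path_weight P (col z) w * f (run z w)) =
        P (col z) c * mass f m (\<delta> z c)"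
      using c z by (subst sum.reindex) (auto simp: mass_def sum_distrib_left col_step mult_ac)
  qed simp
  finally show ?thesis .
qed

abbreviation tail :: "nat \<Rightarrow> 'z \<Rightarrow> real" where
  "tail m z \<equiv> 1 - mass (\<lambda>_. 1) m z"

lemma tail_Suc: "z \<in> Z - F \<Longrightarrow> tail (Suc m) z = (\<Sum>c\<in>{1..r}. P (col z) c * tail m (\<delta> z c))"
  using P_sum[OF col_mem, of z] by (simp add: mass_Suc right_diff_distrib sum_subtractf)

lemma sum_P_mono:
  "u \<in> {1..r} \<Longrightarrow> (\<And>c. c \<in> {1..r} \<Longrightarrow> f c \<le> g c) \<Longrightarrow>
    (\<Sum>c\<in>{1..r}. P u c * f c) \<le> (\<Sum>c\<in>{1..r}. P u c * g c)"
  by (intro sum_mono mult_left_mono P_nonneg)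

lemma mass_mono: "m \<le> m' \<Longrightarrow> z \<in> Z \<Longrightarrow> mass (\<lambda>_. 1) m z \<le> mass (\<lambda>_. 1) m' z"
  unfolding mass_def
  by (rule sum_mono2[OF finite_accepted]) (auto simp: accepted_def intro!: path_weight_nonneg
      dest: set_accepts col_mem)

text \<open>Kraft's inequality for the prefix code of accepted words, derived from the first-letter
  recursion rather than from a probability space.\<close>

lemma tail_nonneg: "z \<in> Z \<Longrightarrow> tail m z \<ge> 0"
proof (induction m arbitrary: z)
  case 0
  then show ?case by (cases "z \<in> F") (simp_all add: mass_final mass_0)
next
  case (Suc m)
  show ?case
  proof (cases "z \<in> F")
    case True
    then show ?thesis by (simp add: mass_final)
  next
    case False
    with Suc.prems have z: "z \<in> Z - F" by simp
    show ?thesis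
      unfolding tail_Suc[OF z] using z
      by (intro sum_nonneg mult_nonneg_nonneg Suc.IH P_nonneg col_mem step_mem) auto
  qed
qed

text \<open>For the reading time T the left side is the mean of min(T, m). Splitting off the first
  letter reproduces the drift condition, which carries the bound from \<open>m\<close> to
  \<open>Suc m\<close>.\<close>

lemma sum_tail_le: "z \<in> Z \<Longrightarrow> (\<Sum>j<m. tail j z) \<le> L z"
proof (induction m arbitrary: z)
  case 0
  then show ?case by (simp add: L_nonneg)
next
  case (Suc m)
  show ?case
  proof (cases "z \<in> F")
    case True
    then show ?thesis using Suc.prems by (simp add: mass_final L_nonneg)
  next
    case False
    with Suc.prems have z: "z \<in> Z - F" by simp
    have "(\<Sum>j<Suc m. tail j z) = 1 + (\<Sum>j<m. tail (Suc j) z)"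
      using False by (simp add: sum.lessThan_Suc_shift mass_0 del: sum.lessThan_Suc)
    also have "(\<Sum>j<m. tail (Suc j) z) = (\<Sum>j<m. \<Sum>c\<in>{1..r}. P (col z) c * tail j (\<delta> z c))"
      by (simp only: tail_Suc[OF z])
    also have "\<dots> = (\<Sum>c\<in>{1..r}. P (col z) c * (\<Sum>j<m. tail j (\<delta> z c)))"
      by (subst sum.swap) (simp only: sum_distrib_left)
    also have "\<dots> \<le> (\<Sum>c\<in>{1..r}. P (col z) c * L (\<delta> z c))"
      using z by (intro sum_P_mono Suc.IH col_mem step_mem) auto
    finally show ?thesis using L_drift[OF z] by linarith
  qed
qed

text \<open>Tails decrease in \<open>m\<close>, so the last of \<open>Suc m\<close> tails is at most
  their average.\<close>

lemma tail_le: "z \<in> Z \<Longrightarrow> tail m z \<le> L z / real (Suc m)"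
proof -
  assume z: "z \<in> Z"
  have "real (Suc m) * tail m z = (\<Sum>j<Suc m. tail m z)"
    by (simp only: sum_constant card_lessThan)
  also have "\<dots> \<le> (\<Sum>j<Suc m. tail j z)"
    by (rule sum_mono) (use z mass_mono in auto)
  also have "\<dots> \<le> L z"
    by (rule sum_tail_le[OF z])
  finally show ?thesis by (simp add: field_simps)
qed

lemma tail_tendsto: "z \<in> Z \<Longrightarrow> (\<lambda>m. tail m z) \<longlonglongrightarrow> 0"
proof (rule tendsto_sandwich[where f="\<lambda>_. 0"])
  assume z: "z \<in> Z"
  show "(\<lambda>m. L z / real (Suc m)) \<longlonglongrightarrow> 0"
    by (rule LIMSEQ_Suc[OF lim_const_over_n])
qed (simp_all only: tail_nonneg tail_le eventually_True tendsto_const)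

text \<open>Optional stopping at a finite horizon: the runs that are not yet absorbed contribute at
  least 0 and at most their probability, because \<open>h\<close> has values between 0 and
  1.\<close>

lemma mass_harmonic:
  assumes h: "\<And>z. z \<in> Z \<Longrightarrow> 0 \<le> h z \<and> h z \<le> 1"
    and harm: "\<And>z. z \<in> Z - F \<Longrightarrow> (\<Sum>c\<in>{1..r}. P (col z) c * h (\<delta> z c)) = h z"
    and z: "z \<in> Z"
  shows "mass h m z \<le> h z \<and> h z \<le> mass h m z + tail m z"
  using z
proof (induction m arbitrary: z)
  case 0
  then show ?case using h by (cases "z \<in> F") (simp_all add: mass_final mass_0)
next
  case (Suc m)
  show ?case
  proof (cases "z \<in> F")
    case True
    then show ?thesis by (simp add: mass_final)
  next
    case False
    with Suc.prems have z: "z \<in> Z - F" by simp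
    have "mass h (Suc m) z \<le> (\<Sum>c\<in>{1..r}. P (col z) c * h (\<delta> z c))"
      unfolding mass_Suc[OF z] by (intro sum_P_mono) (use Suc.IH step_mem[OF z] col_mem z in auto)
    moreover have "(\<Sum>c\<in>{1..r}. P (col z) c * h (\<delta> z c)) \<le>
        (\<Sum>c\<in>{1..r}. P (col z) c * (mass h m (\<delta> z c) + tail m (\<delta> z c)))"
      by (intro sum_P_mono) (use Suc.IH step_mem[OF z] col_mem z in auto)
    ultimately show ?thesis
      unfolding harm[OF z] tail_Suc[OF z] mass_Suc[OF z, of h]
      by (simp add: distrib_left sum.distrib)
  qed
qed

end

section \<open>Renewal structure of the accepted words\<close>

text \<open>The shift by \<open>Suc\<close> leaves out \<open>u 0\<close>, the colour of the
  starting point, which belongs to no word.\<close>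

definition reads :: "(nat \<Rightarrow> 'c) \<Rightarrow> 'c list list \<Rightarrow> bool" where
  "reads u ws \<longleftrightarrow> (\<forall>i<length (concat ws). u (Suc i) = concat ws ! i)"

lemma reads_Nil [simp]: "reads u []"
  by (simp add: reads_def)

lemma reads_append: "reads u (ws @ vs) \<Longrightarrow> reads u ws"
  by (auto simp: reads_def nth_append dest!: spec split: if_splits)

lemma reads_conv_map:
  "reads u ws \<longleftrightarrow> concat ws = map (\<lambda>i. u (Suc i)) [0..<length (concat ws)]"
proof -
  have "(\<forall>i<length xs. f i = xs ! i) \<longleftrightarrow> xs = map f [0..<length xs]" for f and xs :: "'a list"
  proof
    assume "\<forall>i<length xs. f i = xs ! i"
    then show "xs = map f [0..<length xs]"
      by (intro nth_equalityI) simp_all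
  next
    assume eq: "xs = map f [0..<length xs]"
    show "\<forall>i<length xs. f i = xs ! i"
    proof (intro allI impI)
      fix i assume "i < length xs"
      then have "map f [0..<length xs] ! i = f i" by simp
      with eq show "f i = xs ! i" by metis
    qed
  qed
  then show ?thesis by (simp only: reads_def)
qed

text \<open>Initial and final states share colour 1, so after a code word the chain is again where
  reading started: the automaton can be reset to \<open>z0\<close>, and the weight of the next word
  does not depend on the previous ones.\<close>

locale excursions = absorbed_walk r P Z F \<delta> col L
  for r P and Z F :: "'z set" and \<delta> col L +
  fixes z0 :: 'z
  assumes start: "z0 \<in> Z - F" "col z0 = 1"
    and col_final: "z \<in> Z \<inter> F \<Longrightarrow> col z = 1"
begin

definition codes :: "nat \<Rightarrow> nat list list set" where
  "codes n = {ws. length ws = n \<and> (\<forall>w\<in>set ws. accepts z0 w)}"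

text \<open>Unique decodability of a prefix code: of the two first words one is a prefix of the
  other, hence they agree and can be cancelled.\<close>

lemma codes_eqI:
  "ws \<in> codes n \<Longrightarrow> ws' \<in> codes n \<Longrightarrow> concat ws @ a = concat ws' @ b \<Longrightarrow> ws = ws'"
proof (induction n arbitrary: ws ws')
  case 0
  then show ?case by (simp add: codes_def)
next
  case (Suc n)
  from Suc.prems(1,2) obtain v vs v' vs' where
    [simp]: "ws = v # vs" "ws' = v' # vs'" and v: "accepts z0 v" "accepts z0 v'"
    and vs: "vs \<in> codes n" "vs' \<in> codes n"
    by (auto simp: codes_def length_Suc_conv)
  have "v @ (concat vs @ a) = v' @ (concat vs' @ b)"
    using Suc.prems(3) by simp
  then consider us where "v = v' @ us" | us where "v' = v @ us"
    by (auto simp: append_eq_append_conv2)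
  then have "v = v'"
    by cases (use v accepts_prefix_free in fastforce)+
  with Suc.prems(3) Suc.IH[OF vs] show ?case by simp
qed

lemma codes_unique:
  assumes "ws \<in> codes n" "ws' \<in> codes n" "reads u ws" "reads u ws'"
  shows "ws = ws'"
proof -
  let ?l = "length (concat ws)" and ?l' = "length (concat ws')"
  \<comment> \<open>A priori the two segmentations end at different times. Both are continued by the
    remaining colours up to the later end, which gives equal lists.\<close>
  let ?N = "max ?l ?l'" and ?f = "\<lambda>i. u (Suc i)"
  have split: "map ?f [0..<k] @ map ?f [k..<?N] = map ?f [0..<?N]" if "k \<le> ?N" for k
    using that upt_add_eq_append[of 0 k "?N - k"] by (simp only: map_append[symmetric]) simp
  have "map ?f [0..<?l] @ map ?f [?l..<?N] = map ?f [0..<?l'] @ map ?f [?l'..<?N]"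
    by (simp only: split max.cobounded1 max.cobounded2)
  then have "concat ws @ map ?f [?l..<?N] = concat ws' @ map ?f [?l'..<?N]"
    using assms(3,4) unfolding reads_conv_map by metis
  then show ?thesis
    by (rule codes_eqI[OF assms(1,2)])
qed

text \<open>\<open>cycle u n\<close> is the \<open>n\<close>-th code word read along \<open>u\<close>; the value \<open>[]\<close>, not a code word,
  says that there is none.\<close>

definition cycle :: "(nat \<Rightarrow> nat) \<Rightarrow> nat \<Rightarrow> nat list" where
  "cycle u n = (if \<exists>ws\<in>codes (Suc n). reads u ws
     then last (THE ws. ws \<in> codes (Suc n) \<and> reads u ws) else [])"

lemma cycle_last: "ws \<in> codes (Suc n) \<Longrightarrow> reads u ws \<Longrightarrow> cycle u n = last ws"
proof -
  assume ws: "ws \<in> codes (Suc n)" "reads u ws"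
  then have "(THE ws. ws \<in> codes (Suc n) \<and> reads u ws) = ws"
    by (intro the_equality) (auto intro: codes_unique)
  with ws show ?thesis by (auto simp: cycle_def)
qed

lemma cycle_nth:
  assumes ws: "ws \<in> codes n" "reads u ws" and i: "i < n"
  shows "cycle u i = ws ! i"
proof -
  have len: "length ws = n" using ws by (simp add: codes_def)
  have "take (Suc i) ws \<in> codes (Suc i)"
    using ws i by (auto simp: codes_def dest: in_set_takeD)
  moreover have "reads u (take (Suc i) ws)"
    using ws(2) reads_append[of u "take (Suc i) ws" "drop (Suc i) ws"] by simp
  ultimately have "cycle u i = last (take (Suc i) ws)"
    by (rule cycle_last)
  then show ?thesis using len i by (simp add: take_Suc_conv_app_nth)
qed

definition recurrent :: "(nat \<Rightarrow> nat) \<Rightarrow> bool" where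
  "recurrent u \<longleftrightarrow> (\<forall>n. \<exists>ws\<in>codes n. reads u ws)"

lemma recurrent_cycles:
  assumes "recurrent u"
  shows "map (cycle u) [0..<n] \<in> codes n" "reads u (map (cycle u) [0..<n])"
proof -
  obtain ws where ws: "ws \<in> codes n" "reads u ws"
    using assms by (auto simp: recurrent_def)
  have "map (cycle u) [0..<n] = ws"
    using ws cycle_nth[OF ws] by (intro nth_equalityI) (auto simp: codes_def)
  with ws show "map (cycle u) [0..<n] \<in> codes n" "reads u (map (cycle u) [0..<n])"
    by simp_all
qed

lemma accepts_cycle: "recurrent u \<Longrightarrow> accepts z0 (cycle u n)"
  using recurrent_cycles(1)[of u "Suc n"] by (simp add: codes_def)

text \<open>By \<open>codes_unique\<close> the set has at most one element. The infimum is used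
  because it is \<infinity> on the empty set, where \<open>n\<close> code words are never
  completed.\<close>

definition cycle_time :: "(nat \<Rightarrow> nat) \<Rightarrow> nat \<Rightarrow> enat" where
  "cycle_time u n = Inf {enat (length (concat ws)) | ws. ws \<in> codes n \<and> reads u ws}"

text \<open>The right side inspects colours up to time \<open>t\<close> only; this is the stopping
  time property in disguise.\<close>

lemma cycle_time_le_iff:
  "cycle_time u n \<le> enat t \<longleftrightarrow> (\<exists>ws\<in>codes n. reads u ws \<and> length (concat ws) \<le> t)"
proof
  let ?A = "{enat (length (concat ws)) | ws. ws \<in> codes n \<and> reads u ws}"
  assume le: "cycle_time u n \<le> enat t"
  have "?A \<noteq> {}"
  proof
    assume "?A = {}"
    then have "cycle_time u n = \<infinity>"
      by (simp only: cycle_time_def Inf_enat_def if_True simp_thms)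
    with le show False by simp
  qed
  then obtain k where "k \<in> ?A" by blast
  then have "Inf ?A \<in> ?A" by (rule wellorder_InfI)
  with le show "\<exists>ws\<in>codes n. reads u ws \<and> length (concat ws) \<le> t"
    unfolding cycle_time_def by auto
next
  assume "\<exists>ws\<in>codes n. reads u ws \<and> length (concat ws) \<le> t"
  then obtain ws where ws: "ws \<in> codes n" "reads u ws" "length (concat ws) \<le> t" by auto
  have "cycle_time u n \<le> enat (length (concat ws))"
    unfolding cycle_time_def by (rule Inf_lower) (use ws in auto)
  also have "\<dots> \<le> enat t" using ws by simp
  finally show "cycle_time u n \<le> enat t" .
qed

lemma cycle_time_eq:
  assumes "recurrent u"
  shows "cycle_time u n = enat (\<Sum>i<n. length (cycle u i))"
proof -
  let ?ws = "map (cycle u) [0..<n]"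
  have "{enat (length (concat ws)) | ws. ws \<in> codes n \<and> reads u ws} = {enat (length (concat ?ws))}"
    using recurrent_cycles[OF assms, of n] codes_unique by blast
  moreover have "length (concat ?ws) = (\<Sum>i<n. length (cycle u i))"
    by (simp add: length_concat comp_def interv_sum_list_conv_sum_set_nat atLeast0LessThan)
  ultimately show ?thesis
    by (simp add: cycle_time_def)
qed

lemma cycle_time_0 [simp]: "cycle_time u 0 = 0"
  using cycle_time_le_iff[of u 0 0] by (auto simp: codes_def zero_enat_def[symmetric])

lemma path_weight_codes:
  "ws \<in> codes n \<Longrightarrow> path_weight P 1 (concat ws) = (\<Prod>w\<leftarrow>ws. path_weight P 1 w)"
proof (induction n arbitrary: ws)
  case (Suc n)
  then obtain v vs where [simp]: "ws = v # vs" and v: "accepts z0 v" and vs: "vs \<in> codes n"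
    by (auto simp: codes_def length_Suc_conv)
  have "last (1 # v) = 1"
    using last_run[OF v] run_mem[OF v] start col_final by auto
  then show ?case
    using Suc.IH[OF vs] by (simp add: path_weight_append del: last.simps)
qed (simp add: codes_def)

end

text \<open>Of a realization only the law of finite colour words is retained.\<close>

locale excursion_process = excursions r P Z F \<delta> col L z0 + prob_space M
  for r P and Z F :: "'z set" and \<delta> col L z0 and M :: "'w measure" +
  fixes U :: "nat \<Rightarrow> 'w \<Rightarrow> nat"
  assumes U_measurable [measurable]: "\<And>i. U i \<in> M \<rightarrow>\<^sub>M count_space UNIV"
    and U_path: "\<And>xs. set xs \<subseteq> {1..r} \<Longrightarrow>
      \<P>(\<omega> in M. \<forall>i<length xs. U (Suc i) \<omega> = xs ! i) = path_weight P 1 xs"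
begin

abbreviation traj :: "'w \<Rightarrow> nat \<Rightarrow> nat" where
  "traj \<omega> \<equiv> \<lambda>i. U i \<omega>"

lemma measurable_reads [measurable]: "Measurable.pred M (\<lambda>\<omega>. reads (traj \<omega>) ws)"
  unfolding reads_def by measurable

lemma prob_reads:
  assumes "ws \<in> codes n"
  shows "\<P>(\<omega> in M. reads (traj \<omega>) ws) = (\<Prod>w\<leftarrow>ws. path_weight P 1 w)"
proof -
  have "set (concat ws) \<subseteq> {1..r}"
    using assms set_accepts by (fastforce simp: codes_def)
  then show ?thesis
    unfolding reads_def by (simp only: U_path path_weight_codes[OF assms])
qed

text \<open>The words of length at most \<open>m\<close> continue \<open>ws\<close> with total
  conditional probability one minus \<open>tail m z0\<close>. So failure has probability at most
  \<open>tail m z0\<close> for every \<open>m\<close>, and the tails tend to 0.\<close>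

lemma AE_reads_extend:
  assumes ws: "ws \<in> codes n"
  shows "AE \<omega> in M. reads (traj \<omega>) ws \<longrightarrow> (\<exists>w. accepts z0 w \<and> reads (traj \<omega>) (ws @ [w]))"
proof -
  let ?E = "\<lambda>ws. {\<omega>\<in>space M. reads (traj \<omega>) ws}"
  let ?N = "{\<omega>\<in>space M. \<not> (reads (traj \<omega>) ws \<longrightarrow> (\<exists>w. accepts z0 w \<and> reads (traj \<omega>) (ws @ [w])))}"
  have [measurable]: "?E vs \<in> events" "?N \<in> events" for vs
    by measurable
  have ws': "ws @ [w] \<in> codes (Suc n)" if "accepts z0 w" for w
    using ws that by (auto simp: codes_def)
  have bound: "prob ?N \<le> tail m z0" for m
  proof -
    \<comment> \<open>Unique decodability again: a trajectory cannot continue \<open>ws\<close> by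
      two different code words.\<close>
    have disj: "disjoint_family_on (\<lambda>w. ?E (ws @ [w])) (accepted m z0)"
      using codes_unique[OF ws' ws'] by (fastforce simp: disjoint_family_on_def accepted_def)
    have "prob ?N + (\<Sum>w\<in>accepted m z0. prob (?E (ws @ [w]))) =
        prob ?N + prob (\<Union>w\<in>accepted m z0. ?E (ws @ [w]))"
      by (subst finite_measure_finite_Union[OF finite_accepted _ disj]) auto
    also have "\<dots> = prob (?N \<union> (\<Union>w\<in>accepted m z0. ?E (ws @ [w])))"
      by (subst finite_measure_Union) (auto simp: accepted_def finite_accepted[unfolded accepted_def])
    also have "\<dots> \<le> prob (?E ws)"
      by (rule finite_measure_mono) (auto dest: reads_append)
    finally have "prob ?N \<le> prob (?E ws) - (\<Sum>w\<in>accepted m z0. prob (?E (ws @ [w])))"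
      by simp
    also have "(\<Sum>w\<in>accepted m z0. prob (?E (ws @ [w]))) =
        (\<Sum>w\<in>accepted m z0. prob (?E ws) * path_weight P 1 w)"
      by (rule sum.cong) (auto simp: prob_reads[OF ws] prob_reads[OF ws'] accepted_def)
    also have "prob (?E ws) - \<dots> = prob (?E ws) * tail m z0"
      by (simp add: mass_def start sum_distrib_left algebra_simps sum_distrib_right)
    also have "\<dots> \<le> 1 * tail m z0"
      using start by (intro mult_right_mono tail_nonneg) auto
    finally show ?thesis by simp
  qed
  have "prob ?N \<le> 0"
    by (rule LIMSEQ_le_const[OF tail_tendsto[of z0]]) (use bound start in auto)
  then have "prob ?N = 0"
    using measure_nonneg[of M ?N] by linarith
  then show ?thesis
    by (subst (asm) prob_eq_0) auto
qed

lemma AE_recurrent: "AE \<omega> in M. recurrent (traj \<omega>)"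
proof -
  have "AE \<omega> in M. \<forall>n. \<forall>ws\<in>codes n. reads (traj \<omega>) ws \<longrightarrow>
      (\<exists>w. accepts z0 w \<and> reads (traj \<omega>) (ws @ [w]))"
    unfolding AE_all_countable by (auto simp: AE_ball_countable intro: AE_reads_extend)
  then show ?thesis
  proof eventually_elim
    case (elim \<omega>)
    show ?case
      unfolding recurrent_def
    proof
      fix n show "\<exists>ws\<in>codes n. reads (traj \<omega>) ws"
      proof (induction n)
        case (Suc n)
        then obtain ws where "ws \<in> codes n" "reads (traj \<omega>) ws" by auto
        with elim obtain w where "accepts z0 w" "reads (traj \<omega>) (ws @ [w])" by blast
        moreover have "ws @ [w] \<in> codes (Suc n)"
          using \<open>ws \<in> codes n\<close> \<open>accepts z0 w\<close> by (auto simp: codes_def)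
        ultimately show ?case by auto
      qed (auto simp: codes_def)
    qed
  qed
qed

lemma measurable_cycle [measurable]: "(\<lambda>\<omega>. cycle (traj \<omega>) n) \<in> M \<rightarrow>\<^sub>M count_space UNIV"
proof (subst measurable_count_space_eq2_countable, safe)
  fix w
  have eq: "cycle (traj \<omega>) n = w \<longleftrightarrow>
      (\<exists>ws. ws \<in> codes (Suc n) \<and> reads (traj \<omega>) ws \<and> last ws = w) \<or>
      (\<forall>ws. ws \<in> codes (Suc n) \<longrightarrow> \<not> reads (traj \<omega>) ws) \<and> w = []" for \<omega>
  proof (cases "\<exists>ws\<in>codes (Suc n). reads (traj \<omega>) ws")
    case True
    then obtain ws where ws: "ws \<in> codes (Suc n)" "reads (traj \<omega>) ws" by blast
    have uniq: "vs = ws" if "vs \<in> codes (Suc n)" "reads (traj \<omega>) vs" for vs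
      by (rule codes_unique[OF that(1) ws(1) that(2) ws(2)])
    show ?thesis
      unfolding cycle_last[OF ws] using ws uniq by metis
  next
    case False
    then show ?thesis by (auto simp: cycle_def)
  qed
  have "(\<lambda>\<omega>. cycle (traj \<omega>) n) -` {w} \<inter> space M = {\<omega>\<in>space M. cycle (traj \<omega>) n = w}"
    by auto
  also have "\<dots> \<in> events"
    unfolding eq by measurable
  finally show "(\<lambda>\<omega>. cycle (traj \<omega>) n) -` {w} \<inter> space M \<in> events" .
qed auto

lemma prob_cycles_accepted:
  assumes "\<And>i. i < n \<Longrightarrow> accepts z0 (w i)"
  shows "\<P>(\<omega> in M. \<forall>i<n. cycle (traj \<omega>) i = w i) = (\<Prod>i<n. path_weight P 1 (w i))"
proof -
  have ws: "map w [0..<n] \<in> codes n"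
    using assms by (auto simp: codes_def)
  have "\<P>(\<omega> in M. \<forall>i<n. cycle (traj \<omega>) i = w i) = \<P>(\<omega> in M. reads (traj \<omega>) (map w [0..<n]))"
  proof (rule prob_eq_AE)
    show "AE \<omega> in M. (\<forall>i<n. cycle (traj \<omega>) i = w i) \<longleftrightarrow> reads (traj \<omega>) (map w [0..<n])"
      using AE_recurrent
    proof eventually_elim
      case (elim \<omega>)
      show ?case
      proof
        assume "\<forall>i<n. cycle (traj \<omega>) i = w i"
        then have "map w [0..<n] = map (cycle (traj \<omega>)) [0..<n]" by auto
        then show "reads (traj \<omega>) (map w [0..<n])"
          using recurrent_cycles(2)[OF elim, of n] by metis
      next
        assume "reads (traj \<omega>) (map w [0..<n])"
        from cycle_nth[OF ws this] show "\<forall>i<n. cycle (traj \<omega>) i = w i" by simp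
      qed
    qed
  qed measurable
  also have "\<dots> = (\<Prod>i<n. path_weight P 1 (w i))"
    by (simp add: prob_reads[OF ws] comp_def prod.distinct_set_conv_list[symmetric] atLeast0LessThan)
  finally show ?thesis .
qed

lemma prob_cycle_0: "accepts z0 w \<Longrightarrow> \<P>(\<omega> in M. cycle (traj \<omega>) 0 = w) = path_weight P 1 w"
  using prob_cycles_accepted[of 1 "\<lambda>_. w"] by simp

text \<open>For accepted words both sides are products of weights. A word that is not accepted, such
  as the default \<open>[]\<close>, is almost surely never a cycle, so both sides vanish.\<close>

lemma cycles_iid:
  "\<P>(\<omega> in M. \<forall>i<n. cycle (traj \<omega>) i \<in> A i) = (\<Prod>i<n. \<P>(\<omega> in M. cycle (traj \<omega>) 0 \<in> A i))"
proof (rule iid_eventsI_countable)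
  fix n and w :: "nat \<Rightarrow> nat list"
  show "\<P>(\<omega> in M. \<forall>i<n. cycle (traj \<omega>) i = w i) = (\<Prod>i<n. \<P>(\<omega> in M. cycle (traj \<omega>) 0 = w i))"
  proof (cases "\<forall>i<n. accepts z0 (w i)")
    case True
    then show ?thesis by (simp add: prob_cycles_accepted prob_cycle_0)
  next
    case False
    then obtain j where j: "j < n" "\<not> accepts z0 (w j)" by auto
    have null: "\<P>(\<omega> in M. cycle (traj \<omega>) k = w j) = 0" for k
    proof (subst prob_Collect_eq_0)
      show "AE \<omega> in M. \<not> cycle (traj \<omega>) k = w j"
        using AE_recurrent by eventually_elim (use j accepts_cycle in metis)
    qed measurable
    have "\<P>(\<omega> in M. \<forall>i<n. cycle (traj \<omega>) i = w i) \<le> \<P>(\<omega> in M. cycle (traj \<omega>) j = w j)"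
      using j by (intro finite_measure_mono) auto
    then have "\<P>(\<omega> in M. \<forall>i<n. cycle (traj \<omega>) i = w i) = 0"
      using null[of j] by (simp add: measure_le_0_iff)
    moreover have "(\<Prod>i<n. \<P>(\<omega> in M. cycle (traj \<omega>) 0 = w i)) = 0"
      by (intro prod_zero bexI[of _ j]) (use j null[of 0] in simp_all)
    ultimately show ?thesis by simp
  qed
qed measurable

lemma prob_cycle_0_finite:
  assumes "finite B" "\<And>w. w \<in> B \<Longrightarrow> accepts z0 w"
  shows "\<P>(\<omega> in M. cycle (traj \<omega>) 0 \<in> B) = (\<Sum>w\<in>B. path_weight P 1 w)"
proof -
  have "\<P>(\<omega> in M. cycle (traj \<omega>) 0 \<in> B) = prob (\<Union>w\<in>B. {\<omega>\<in>space M. cycle (traj \<omega>) 0 = w})"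
    by (intro arg_cong[where f=prob]) auto
  also have "\<dots> = (\<Sum>w\<in>B. \<P>(\<omega> in M. cycle (traj \<omega>) 0 = w))"
    by (rule finite_measure_finite_Union[OF assms(1)]) (auto simp: disjoint_family_on_def)
  also have "\<dots> = (\<Sum>w\<in>B. path_weight P 1 w)"
    using assms(2) by (simp add: prob_cycle_0)
  finally show ?thesis .
qed

lemma prob_cycle_not_accepted: "\<P>(\<omega> in M. cycle (traj \<omega>) 0 \<notin> accepted m z0) = tail m z0"
proof -
  have "\<P>(\<omega> in M. cycle (traj \<omega>) 0 \<in> accepted m z0) = mass (\<lambda>_. 1) m z0"
    by (subst prob_cycle_0_finite) (simp_all add: finite_accepted mass_def start, simp add: accepted_def)
  then show ?thesis
    by (subst prob_neg) auto
qed

text \<open>Both numbers lie between \<open>mass h m z0\<close> and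
  \<open>mass h m z0 + tail m z0\<close>, an interval that shrinks to a point as \<open>m\<close>
  grows.\<close>

lemma prob_run_cycle:
  assumes h: "\<And>z. z \<in> Z \<Longrightarrow> 0 \<le> h z \<and> h z \<le> 1"
    and harm: "\<And>z. z \<in> Z - F \<Longrightarrow> (\<Sum>c\<in>{1..r}. P (col z) c * h (\<delta> z c)) = h z"
    and bd: "\<And>z. z \<in> Z \<inter> F \<Longrightarrow> h z = of_bool (Q z)"
  shows "\<P>(\<omega> in M. Q (run z0 (cycle (traj \<omega>) 0))) = h z0"
proof -
  let ?p = "\<P>(\<omega> in M. Q (run z0 (cycle (traj \<omega>) 0)))"
  have z0: "z0 \<in> Z" using start by simp
  have bound: "\<bar>?p - h z0\<bar> \<le> tail m z0" for m
  proof -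
    let ?B = "{w\<in>accepted m z0. Q (run z0 w)}"
    have "mass h m z0 = (\<Sum>w\<in>accepted m z0. if Q (run z0 w) then path_weight P 1 w else 0)"
      unfolding mass_def start
      by (rule sum.cong) (use bd run_mem z0 in \<open>auto simp: accepted_def\<close>)
    also have "\<dots> = (\<Sum>w\<in>?B. path_weight P 1 w)"
      by (rule sum.inter_filter[symmetric, OF finite_accepted])
    also have "\<dots> = \<P>(\<omega> in M. cycle (traj \<omega>) 0 \<in> ?B)"
      by (rule prob_cycle_0_finite[symmetric]) (simp_all add: finite_accepted, simp add: accepted_def)
    finally have B: "\<P>(\<omega> in M. cycle (traj \<omega>) 0 \<in> ?B) = mass h m z0" ..
    have lower: "\<P>(\<omega> in M. cycle (traj \<omega>) 0 \<in> ?B) \<le> ?p"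
      by (rule finite_measure_mono) auto
    have "?p \<le> prob ({\<omega>\<in>space M. cycle (traj \<omega>) 0 \<in> ?B} \<union> {\<omega>\<in>space M. cycle (traj \<omega>) 0 \<notin> accepted m z0})"
      by (rule finite_measure_mono) auto
    also have "\<dots> \<le> \<P>(\<omega> in M. cycle (traj \<omega>) 0 \<in> ?B) + \<P>(\<omega> in M. cycle (traj \<omega>) 0 \<notin> accepted m z0)"
      by (rule measure_Un_le) auto
    finally have upper: "?p \<le> mass h m z0 + tail m z0"
      by (simp only: B prob_cycle_not_accepted)
    have "mass h m z0 \<le> h z0" "h z0 \<le> mass h m z0 + tail m z0"
      using mass_harmonic[where h=h, OF h harm z0, of m] by blast+
    with lower upper show ?thesis
      unfolding B abs_le_iff by linarith
  qed
  have "\<bar>?p - h z0\<bar> \<le> 0"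
    by (rule LIMSEQ_le_const[OF tail_tendsto[OF z0]]) (use bound in auto)
  then show ?thesis by simp
qed

text \<open>The mean of a natural-valued variable is the sum of its tails, and the partial sums of
  these are bounded by \<open>L z0\<close>.\<close>

lemma integrable_length_cycle: "integrable M (\<lambda>\<omega>. real (length (cycle (traj \<omega>) 0)))"
proof (rule integrableI_bounded)
  have z0: "z0 \<in> Z" using start by simp
  have tail_eq: "\<P>(\<omega> in M. m < length (cycle (traj \<omega>) 0)) = tail m z0" for m
    unfolding prob_cycle_not_accepted[symmetric]
  proof (rule prob_eq_AE)
    show "AE \<omega> in M. (m < length (cycle (traj \<omega>) 0)) = (cycle (traj \<omega>) 0 \<notin> accepted m z0)"
      using AE_recurrent by eventually_elim (auto simp: accepted_def accepts_cycle)
  qed measurable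
  have "(\<integral>\<^sup>+\<omega>. ennreal (norm (real (length (cycle (traj \<omega>) 0)))) \<partial>M) =
      (\<integral>\<^sup>+\<omega>. of_nat (length (cycle (traj \<omega>) 0)) \<partial>M)"
    by (simp add: ennreal_of_nat_eq_real_of_nat)
  also have "\<dots> = (\<Sum>m. emeasure M {\<omega>\<in>space M. m < length (cycle (traj \<omega>) 0)})"
    by (rule nn_integral_nat_function) measurable
  also have "\<dots> = (\<Sum>m. ennreal (tail m z0))"
    by (simp add: emeasure_eq_measure tail_eq)
  also have "\<dots> \<le> ennreal (L z0)"
    unfolding suminf_eq_SUP
    by (rule SUP_least) (use sum_tail_le[OF z0] tail_nonneg[OF z0] in \<open>simp add: sum_ennreal ennreal_leI\<close>)
  also have "\<dots> < \<infinity>" by simp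
  finally show "(\<integral>\<^sup>+\<omega>. ennreal (norm (real (length (cycle (traj \<omega>) 0)))) \<partial>M) < \<infinity>" .
qed measurable

end

section \<open>Linearization from a labelled automaton\<close>

text \<open>A step between two colours always multiplies by the same label, so the group component
  is a function of the colours. \<open>disp\<close> accumulates the labels since the current word
  began. In \<open>exit_law\<close> the witness \<open>h\<close> is the probability, as a function
  of the state, that the completed word has displacement \<open>g\<close>.\<close>

locale labelled_excursions = group G + excursions r P Z F \<delta> col L z0
  for G :: "('a, 'b) monoid_scheme" (structure) and r P and Z F :: "'z set" and \<delta> col L z0 +
  fixes S :: "'a set" and p :: "'a pmf" and lab :: "nat \<Rightarrow> nat \<Rightarrow> 'a" and disp :: "'z \<Rightarrow> 'a"
  assumes countable_G: "countable (carrier G)"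
    and irreducible: "irreducible_matrix r P"
    and lab_closed: "\<lbrakk>u \<in> {1..r}; v \<in> {1..r}\<rbrakk> \<Longrightarrow> lab u v \<in> carrier G"
    and lab_S: "\<lbrakk>u \<in> {1..r}; v \<in> {1..r}; P u v > 0\<rbrakk> \<Longrightarrow> lab u v \<in> S"
    and lab_generate: "generate G {lab u v | u v. u \<in> {1..r} \<and> v \<in> {1..r} \<and> P u v > 0} = carrier G"
    and disp_start: "disp z0 = \<one>"
    and disp_closed: "z \<in> Z \<Longrightarrow> disp z \<in> carrier G"
    and disp_step: "\<lbrakk>z \<in> Z - F; c \<in> {1..r}; P (col z) c > 0\<rbrakk> \<Longrightarrow>
      disp (\<delta> z c) = disp z \<otimes> lab (col z) c"
    and exit_law: "g \<in> carrier G \<Longrightarrow> \<exists>h. (\<forall>z\<in>Z. 0 \<le> h z \<and> h z \<le> 1) \<and>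
      (\<forall>z\<in>Z - F. (\<Sum>c\<in>{1..r}. P (col z) c * h (\<delta> z c)) = h z) \<and>
      (\<forall>z\<in>Z \<inter> F. h z = of_bool (disp z = g)) \<and> h z0 = pmf p g"
begin

definition walk :: "'a \<Rightarrow> nat \<Rightarrow> nat \<Rightarrow> real" where
  "walk g u v = (if g = lab u v then P u v else 0)"

abbreviation states :: "('a \<times> nat) set" where
  "states \<equiv> carrier G \<times> {1..r}"

lemma r_pos: "1 \<le> r"
  using col_mem[of z0] start by auto

lemma one_mem: "1 \<in> {1..r}"
  using r_pos by simp

lemma countable_states: "countable states"
  using countable_G by simp

lemma colour_matrix_walk:
  assumes "u \<in> {1..r}" "v \<in> {1..r}"
  shows "colour_matrix G walk u v = P u v" and "(\<lambda>g. walk g u v) summable_on carrier G"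
proof -
  have "colour_matrix G walk u v = (\<Sum>\<^sub>\<infinity>g\<in>{lab u v}. walk g u v)"
    unfolding colour_matrix_def
    by (rule infsum_cong_neutral) (use lab_closed[OF assms] in \<open>auto simp: walk_def\<close>)
  then show "colour_matrix G walk u v = P u v"
    by (simp add: walk_def)
  have "(\<lambda>g. walk g u v) summable_on carrier G \<longleftrightarrow> (\<lambda>g. walk g u v) summable_on {lab u v}"
    by (rule summable_on_cong_neutral) (use lab_closed[OF assms] in \<open>auto simp: walk_def\<close>)
  then show "(\<lambda>g. walk g u v) summable_on carrier G"
    by simp
qed

lemma coloured_walk: "coloured_walk G r walk"
  unfolding coloured_walk_def
proof (intro conjI ballI r_pos)
  show "(\<Sum>v\<in>{1..r}. colour_matrix G walk u v) = 1" if "u \<in> {1..r}" for u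
    using P_sum[OF that] that by (simp add: colour_matrix_walk del: atLeastAtMost_iff)
qed (use P_nonneg colour_matrix_walk in \<open>auto simp: walk_def\<close>)

lemma support_walk:
  "coloured_support G r walk = {lab u v | u v. u \<in> {1..r} \<and> v \<in> {1..r} \<and> P u v > 0}"
proof -
  have "P u v \<noteq> 0 \<longleftrightarrow> P u v > 0" if "u \<in> {1..r}" "v \<in> {1..r}" for u v
    using P_nonneg[OF that] by auto
  then show ?thesis
    using lab_closed unfolding coloured_support_def walk_def
    by (auto simp del: atLeastAtMost_iff split: if_splits)
qed

lemma quasi_irreducible: "quasi_irreducible G r walk"
proof -
  have "{(a, b). a \<in> {1..r} \<and> b \<in> {1..r} \<and> colour_matrix G walk a b > 0} =
      {(a, b). a \<in> {1..r} \<and> b \<in> {1..r} \<and> P a b > 0}"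
    using colour_matrix_walk(1) by auto
  then show ?thesis
    using irreducible lab_generate
    unfolding quasi_irreducible_def irreducible_matrix_def support_walk by simp
qed

lemma nearest_neighbour: "nearest_neighbour G S r walk"
  unfolding nearest_neighbour_def support_walk using lab_S by auto

lemma coloured_kernel_walk:
  assumes "g \<in> carrier G" "h \<in> carrier G" "u \<in> {1..r}" "v \<in> {1..r}"
  shows "coloured_kernel G walk (g, u) (h, v) = (if h = g \<otimes> lab u v then P u v else 0)"
proof -
  have "inv g \<otimes> h = lab u v \<longleftrightarrow> h = g \<otimes> lab u v"
    using assms lab_closed[of u v] by (metis inv_closed inv_solve_left m_closed)
  then show ?thesis by (simp add: coloured_kernel_def walk_def)
qed

lemma markov_chain_exists:
  "\<exists>(M :: (nat \<Rightarrow> 'a \<times> nat) measure) Y. markov_chain M states (coloured_kernel G walk) (\<one>, 1) Y"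
proof -
  have "\<exists>R. \<forall>c. pmf R c = (if c \<in> {1..r} then P u c else 0)" if "u \<in> {1..r}" for u
    using pmf_of_weights[of "{1..r}" "P u"] P_nonneg P_sum that by (metis finite_atLeastAtMost)
  then obtain R where R: "\<And>u c. u \<in> {1..r} \<Longrightarrow> pmf (R u) c = (if c \<in> {1..r} then P u c else 0)"
    by metis
  \<comment> \<open>A sampled map proposes a successor for every colour at once, with independent
    components, and the current colour selects one. \<open>clip\<close> keeps the update inside the
    state space for proposals outside \<open>{1..r}\<close>, which have probability 0.\<close>
  define clip where "clip v = (if v \<in> {1..r} then v else 1)" for v
  have clip_mem: "clip v \<in> {1..r}" for v
    using one_mem by (simp add: clip_def)
  define f where "f a x = (fst x \<otimes> lab (snd x) (clip (a (snd x))), clip (a (snd x)))"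
    for a :: "nat \<Rightarrow> nat" and x :: "'a \<times> nat"
  show ?thesis
  proof (rule markov_chain_random_maps)
    show "countable states" by (rule countable_states)
    show "(\<one>, 1) \<in> states" using one_mem by simp
    show "f a x \<in> states" if "x \<in> states" for a x
      using that clip_mem lab_closed by (auto simp: f_def simp del: atLeastAtMost_iff)
    fix x y assume "x \<in> states" "y \<in> states"
    then obtain g u h v where xy: "x = (g, u)" "y = (h, v)" and
      mem: "g \<in> carrier G" "h \<in> carrier G" "u \<in> {1..r}" "v \<in> {1..r}" by auto
    show "measure_pmf.prob (Pi_pmf {1..r} 1 R) {a. f a x = y} = coloured_kernel G walk x y"
    proof (cases "h = g \<otimes> lab u v")
      case True
      have "{a. f a x = y} = {a. clip (a u) = v}"
        using True by (auto simp: f_def xy)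
      also have "measure_pmf.prob (Pi_pmf {1..r} 1 R) {a. clip (a u) = v} =
          measure_pmf.prob (map_pmf (\<lambda>a. a u) (Pi_pmf {1..r} 1 R)) {c. clip c = v}"
        by (simp add: vimage_def)
      also have "map_pmf (\<lambda>a. a u) (Pi_pmf {1..r} 1 R) = R u"
        using mem by (subst Pi_pmf_component) auto
      also have "measure_pmf.prob (R u) {c. clip c = v} = measure_pmf.prob (R u) {v}"
        by (rule measure_prob_cong_0) (use mem R in \<open>auto simp: clip_def split: if_splits\<close>)
      also have "\<dots> = P u v"
        using mem R by (simp add: measure_pmf_single)
      finally show ?thesis
        using True mem by (simp add: xy coloured_kernel_walk del: atLeastAtMost_iff)
    next
      case False
      then have "{a. f a x = y} = {}"
        by (auto simp: f_def xy)
      then show ?thesis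
        using False mem by (simp add: xy coloured_kernel_walk del: atLeastAtMost_iff)
    qed
  qed
qed

text \<open>The automaton shadows the walk: \<open>g\<close> is the position where the word began,
  and the walk stays at \<open>g\<close> times the displacement of the current state. Positive
  transition probabilities are required because \<open>disp_step\<close> holds only along
  them.\<close>

lemma displacement_run:
  assumes y: "\<And>i. y i \<in> carrier G" and u: "\<And>i. u i \<in> {1..r}"
    and step: "\<And>i. y (Suc i) = y i \<otimes> lab (u i) (u (Suc i)) \<and> P (u i) (u (Suc i)) > 0"
    and g: "g \<in> carrier G"
  shows "accepts z w \<Longrightarrow> z \<in> Z \<Longrightarrow> u t = col z \<Longrightarrow> y t = g \<otimes> disp z \<Longrightarrow>
    (\<And>i. i < length w \<Longrightarrow> u (Suc (t + i)) = w ! i) \<Longrightarrow>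
    y (t + length w) = g \<otimes> disp (run z w) \<and> u (t + length w) = col (run z w)"
proof (induction w arbitrary: z t)
  case (Cons c w)
  have c: "u (Suc t) = c" using Cons.prems(5)[of 0] by simp
  have z: "z \<in> Z - F" "c \<in> {1..r}" "accepts (\<delta> z c) w" using Cons.prems by auto
  have "y (Suc t) = g \<otimes> disp z \<otimes> lab (col z) c" "P (col z) c > 0"
    using step[of t] Cons.prems c by auto
  then have "y (Suc t) = g \<otimes> disp (\<delta> z c)"
    using z disp_step[OF z(1,2)] disp_closed lab_closed g col_mem by (auto simp: m_assoc)
  moreover have "u (Suc t) = col (\<delta> z c)"
    using c col_step z by simp
  moreover have "u (Suc (Suc t + i)) = w ! i" if "i < length w" for i
    using Cons.prems(5)[of "Suc i"] that by simp
  ultimately have "y (Suc t + length w) = g \<otimes> disp (run (\<delta> z c) w) \<and>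
      u (Suc t + length w) = col (run (\<delta> z c) w)"
    using z step_mem by (intro Cons.IH) auto
  then show ?case by simp
qed simp

primrec label_product :: "(nat \<Rightarrow> nat) \<Rightarrow> nat \<Rightarrow> 'a" where
  "label_product u 0 = \<one>"
| "label_product u (Suc n) = label_product u n \<otimes> lab (u n) (u (Suc n))"

lemma label_product_closed:
  "(\<And>i. i \<le> n \<Longrightarrow> u i \<in> {1..r}) \<Longrightarrow> label_product u n \<in> carrier G"
  by (induction n) (auto intro!: m_closed lab_closed simp del: atLeastAtMost_iff)

end

section \<open>An arbitrary realization of the coloured walk\<close>

locale walk_realization = labelled_excursions G r P Z F \<delta> col L z0 S p lab disp
  for G :: "('a, 'b) monoid_scheme" (structure) and r P and Z F :: "'z set"
    and \<delta> col L z0 S p lab disp +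
  fixes M :: "'w measure" and Y :: "nat \<Rightarrow> 'w \<Rightarrow> 'a \<times> nat"
  assumes mc: "markov_chain M states (coloured_kernel G walk) (\<one>, 1) Y"
begin

sublocale prob_space M
  using mc by (simp add: markov_chain_def)

lemma Y_measurable: "Y n \<in> M \<rightarrow>\<^sub>M count_space states"
  using mc by (simp add: markov_chain_def)

definition regular :: "'w \<Rightarrow> bool" where
  "regular \<omega> \<longleftrightarrow> \<omega> \<in> space M \<and> Y 0 \<omega> = (\<one>, 1) \<and>
     (\<forall>n. fst (Y (Suc n) \<omega>) = fst (Y n \<omega>) \<otimes> lab (snd (Y n \<omega>)) (snd (Y (Suc n) \<omega>)) \<and>
          P (snd (Y n \<omega>)) (snd (Y (Suc n) \<omega>)) > 0)"

lemma Y_states: "\<omega> \<in> space M \<Longrightarrow> Y n \<omega> \<in> states"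
  using measurable_space[OF Y_measurable, of \<omega> n] by simp

lemma Y_mem: "\<omega> \<in> space M \<Longrightarrow> fst (Y n \<omega>) \<in> carrier G \<and> snd (Y n \<omega>) \<in> {1..r}"
  using Y_states[of \<omega> n] by (simp only: mem_Times_iff)

lemma AE_regular: "AE \<omega> in M. regular \<omega>"
proof -
  have "AE \<omega> in M. Y 0 \<omega> = (\<one>, 1)"
    using mc by (simp add: markov_chain_def)
  with AE_space markov_chain_AE_steps[OF mc countable_states] show ?thesis
  proof eventually_elim
    case (elim \<omega>)
    show ?case
      unfolding regular_def
    proof (intro conjI allI elim)
      fix n
      obtain g u h v where eq: "Y n \<omega> = (g, u)" "Y (Suc n) \<omega> = (h, v)"
        by (meson surj_pair)
      have "coloured_kernel G walk (g, u) (h, v) \<noteq> 0"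
        using elim(2) eq by metis
      then show "fst (Y (Suc n) \<omega>) = fst (Y n \<omega>) \<otimes> lab (snd (Y n \<omega>)) (snd (Y (Suc n) \<omega>))"
        "P (snd (Y n \<omega>)) (snd (Y (Suc n) \<omega>)) > 0"
        using Y_mem[OF elim(1), of n] Y_mem[OF elim(1), of "Suc n"] P_nonneg[of u v]
        by (auto simp: eq coloured_kernel_walk less_le split: if_splits simp del: atLeastAtMost_iff)
    qed
  qed
qed

text \<open>Almost surely the colours force the positions, so the event on colours is, up to a null
  set, the event of following the single path \<open>y\<close>.\<close>

lemma colours_path_prob:
  assumes xs: "set xs \<subseteq> {1..r}"
  shows "\<P>(\<omega> in M. \<forall>i<length xs. snd (Y (Suc i) \<omega>) = xs ! i) = path_weight P 1 xs"
proof -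
  let ?n = "length xs" and ?c = "\<lambda>i. (1 # xs) ! i"
  define y where "y i = (label_product ?c i, ?c i)" for i
  have c_mem: "?c i \<in> {1..r}" if "i \<le> ?n" for i
  proof -
    have "?c i \<in> set (1 # xs)" using that by (intro nth_mem) simp
    with xs one_mem show ?thesis by auto
  qed
  have y_mem: "y i \<in> states" if "i \<le> ?n" for i
    unfolding y_def by (intro SigmaI label_product_closed c_mem) (use that in auto)
  have meas: "{\<omega>\<in>space M. Y i \<omega> \<in> A} \<in> events" if "A \<subseteq> states" for i A
  proof -
    have "Y i -` A \<inter> space M = {\<omega>\<in>space M. Y i \<omega> \<in> A}" by auto
    with measurable_sets[OF Y_measurable, of A i] that show ?thesis by simp
  qed
  have ev: "{\<omega>\<in>space M. snd (Y i \<omega>) = c} \<in> events" for i c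
  proof -
    have "{\<omega>\<in>space M. snd (Y i \<omega>) = c} = {\<omega>\<in>space M. Y i \<omega> \<in> {x\<in>states. snd x = c}}"
      by (rule Collect_cong) (use Y_states[of _ i] in blast)
    also have "\<dots> \<in> events" by (rule meas) auto
    finally show ?thesis .
  qed
  have "\<P>(\<omega> in M. \<forall>i<?n. snd (Y (Suc i) \<omega>) = xs ! i) = \<P>(\<omega> in M. \<forall>i\<le>?n. Y i \<omega> = y i)"
  proof (rule prob_eq_AE)
    show "AE \<omega> in M. (\<forall>i<?n. snd (Y (Suc i) \<omega>) = xs ! i) \<longleftrightarrow> (\<forall>i\<le>?n. Y i \<omega> = y i)"
      using AE_regular
    proof eventually_elim
      case (elim \<omega>)
      show ?case
      proof
        assume a: "\<forall>i<?n. snd (Y (Suc i) \<omega>) = xs ! i"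
        have "Y i \<omega> = y i" if "i \<le> ?n" for i
          using that
        proof (induction i)
          case 0
          then show ?case using elim by (simp add: regular_def y_def)
        next
          case (Suc i)
          then have Yi: "Y i \<omega> = y i" by simp
          have "snd (Y (Suc i) \<omega>) = ?c (Suc i)" using a Suc by simp
          moreover have "fst (Y (Suc i) \<omega>) = fst (Y i \<omega>) \<otimes> lab (snd (Y i \<omega>)) (snd (Y (Suc i) \<omega>))"
            using elim by (simp add: regular_def)
          ultimately show ?case
            unfolding Yi by (intro prod_eqI) (simp_all add: y_def)
        qed
        then show "\<forall>i\<le>?n. Y i \<omega> = y i" by blast
      next
        assume a: "\<forall>i\<le>?n. Y i \<omega> = y i"
        show "\<forall>i<?n. snd (Y (Suc i) \<omega>) = xs ! i"
        proof (intro allI impI)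
          fix i assume "i < ?n"
          then have "Y (Suc i) \<omega> = y (Suc i)" using a by simp
          then show "snd (Y (Suc i) \<omega>) = xs ! i" by (simp add: y_def)
        qed
      qed
    qed
    have "{\<omega>\<in>space M. \<forall>i\<in>{..?n}. Y i \<omega> \<in> {y i}} \<in> events"
    proof (rule sets.sets_Collect_finite_All')
      fix i assume "i \<in> {..?n}"
      then have "{y i} \<subseteq> states" using y_mem[of i] by blast
      then show "{\<omega>\<in>space M. Y i \<omega> \<in> {y i}} \<in> events" by (rule meas)
    qed auto
    then show "{\<omega>\<in>space M. \<forall>i\<le>?n. Y i \<omega> = y i} \<in> events"
      by (simp only: Ball_def atMost_iff singleton_iff)
    show "{\<omega>\<in>space M. \<forall>i<?n. snd (Y (Suc i) \<omega>) = xs ! i} \<in> events"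
    proof (cases "xs = []")
      case False
      have "{\<omega>\<in>space M. \<forall>i\<in>{..<?n}. snd (Y (Suc i) \<omega>) = xs ! i} \<in> events"
        by (rule sets.sets_Collect_finite_All'[OF ev]) (use False in auto)
      then show ?thesis by (simp only: Ball_def lessThan_iff)
    qed simp
  qed
  also have "\<dots> = (\<Prod>i<?n. coloured_kernel G walk (y i) (y (Suc i)))"
  proof -
    have "y 0 = (\<one>, 1)" by (simp add: y_def)
    then show ?thesis
      using markov_chain_path_prob[OF mc y_mem] by simp
  qed
  also have "\<dots> = (\<Prod>i<?n. P (?c i) (xs ! i))"
  proof (rule prod.cong)
    fix i assume "i \<in> {..<?n}"
    then show "coloured_kernel G walk (y i) (y (Suc i)) = P (?c i) (xs ! i)"
      using y_mem[of i] y_mem[of "Suc i"] by (simp add: y_def coloured_kernel_walk)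
  qed simp
  also have "\<dots> = path_weight P 1 xs"
    by (simp add: path_weight_conv_prod)
  finally show ?thesis .
qed

sublocale excursion_process r P Z F \<delta> col L z0 M "\<lambda>n \<omega>. snd (Y n \<omega>)"
proof
  show "(\<lambda>\<omega>. snd (Y n \<omega>)) \<in> M \<rightarrow>\<^sub>M count_space UNIV" for n
    by (rule measurable_compose[OF Y_measurable]) simp
qed (rule colours_path_prob)

definition time :: "nat \<Rightarrow> 'w \<Rightarrow> enat" where
  "time n \<omega> = cycle_time (traj \<omega>) n"

definition position :: "nat \<Rightarrow> 'w \<Rightarrow> 'a" where
  "position n \<omega> = fst (Y (the_enat (time n \<omega>)) \<omega>)"

lemma time_le_iff:
  "time n \<omega> \<le> enat t \<longleftrightarrow> (\<exists>ws\<in>codes n. reads (traj \<omega>) ws \<and> length (concat ws) \<le> t)"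
  by (simp add: time_def cycle_time_le_iff)

lemma measurable_time [measurable]: "time n \<in> M \<rightarrow>\<^sub>M count_space UNIV"
proof (subst measurable_count_space_eq2_countable, safe)
  fix t
  have le: "Measurable.pred M (\<lambda>\<omega>. time n \<omega> \<le> enat k)" for k
    unfolding time_le_iff Bex_def by measurable
  have "time n -` {t} \<inter> space M = {\<omega>\<in>space M. (\<forall>k. t \<le> enat k \<longleftrightarrow> time n \<omega> \<le> enat k)}"
  proof -
    \<comment> \<open>An extended natural number is determined by the finite numbers above it, so
      the value \<infinity> needs no separate treatment.\<close>
    have "time n \<omega> = t \<longleftrightarrow> (\<forall>k. t \<le> enat k \<longleftrightarrow> time n \<omega> \<le> enat k)" for \<omega>
      by (cases t; cases "time n \<omega>") (auto, metis order_refl order_antisym)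
    then show ?thesis by auto
  qed
  also have "\<dots> \<in> events"
    using le by measurable
  finally show "time n -` {t} \<inter> space M \<in> events" .
qed auto

lemma stopping_time_time: "stopping_time (natural_filtration M states Y) (time n)"
proof
  fix t
  let ?F = "natural_filtration M states Y t"
  have gen: "{Y i -` A \<inter> space M | i A. enat i \<le> t \<and> A \<subseteq> states} \<subseteq> Pow (space M)"
    by auto
  have space_F: "space ?F = space M"
    unfolding natural_filtration_def using gen by (rule space_measure_of)
  have const: "Measurable.pred ?F (\<lambda>_. b)" for b
    by simp
  show "Measurable.pred ?F (\<lambda>\<omega>. time n \<omega> \<le> t)"
  proof (cases t)
    case (enat k)
    have colour: "Measurable.pred ?F (\<lambda>\<omega>. snd (Y i \<omega>) = c)" if "i \<le> k" for i c
    proof -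
      have "{\<omega>\<in>space M. snd (Y i \<omega>) = c} = Y i -` {x\<in>states. snd x = c} \<inter> space M"
        using Y_states[of _ i] by blast
      also have "\<dots> \<in> sets ?F"
      proof -
        have "Y i -` {x\<in>states. snd x = c} \<inter> space M \<in>
            {Y i -` A \<inter> space M | i A. enat i \<le> t \<and> A \<subseteq> states}"
          using that enat
          by (intro CollectI exI[of _ i] exI[of _ "{x\<in>states. snd x = c}"] conjI refl) auto
        then show ?thesis
          unfolding natural_filtration_def using gen by (simp only: sets_measure_of sigma_sets.Basic)
      qed
      finally show ?thesis by (simp only: pred_def space_F)
    qed
    have "Measurable.pred ?F (\<lambda>\<omega>. \<exists>ws. ws \<in> codes n \<and> reads (traj \<omega>) ws \<and> length (concat ws) \<le> k)"
    proof (intro pred_intros_countable)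
      fix ws
      show "Measurable.pred ?F (\<lambda>\<omega>. ws \<in> codes n \<and> reads (traj \<omega>) ws \<and> length (concat ws) \<le> k)"
      \<comment> \<open>Longer words make the predicate constantly false; the others look at colours
        no later than time \<open>k\<close>.\<close>
      proof (cases "length (concat ws) \<le> k")
        case True
        have "Measurable.pred ?F (\<lambda>\<omega>. \<forall>i\<in>{..<length (concat ws)}. snd (Y (Suc i) \<omega>) = concat ws ! i)"
          by (intro pred_intros_finite colour) (use True in auto)
        moreover have "(ws \<in> codes n \<and> reads (traj \<omega>) ws \<and> length (concat ws) \<le> k) =
            (ws \<in> codes n \<and> (\<forall>i\<in>{..<length (concat ws)}. snd (Y (Suc i) \<omega>) = concat ws ! i))" for \<omega>
          using True by (simp only: reads_def Ball_def lessThan_iff simp_thms)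
        ultimately show ?thesis
          by (cases "ws \<in> codes n") (simp_all only: simp_thms const)
      next
        case False
        then show ?thesis by (simp only: simp_thms const)
      qed
    qed
    then show ?thesis
      by (simp only: enat time_le_iff Bex_def)
  next
    case infinity
    then show ?thesis using const[of True] by (simp only: enat_ord_code)
  qed
qed

lemma position_eq:
  assumes "regular \<omega>" "recurrent (traj \<omega>)"
  shows "snd (Y (the_enat (time n \<omega>)) \<omega>) = 1"
    and "position 0 \<omega> = \<one>"
    and "position (Suc n) \<omega> = position n \<omega> \<otimes> disp (run z0 (cycle (traj \<omega>) n))"
    and "position n \<omega> \<in> carrier G"
proof -
  let ?T = "\<lambda>n. \<Sum>i<n. length (cycle (traj \<omega>) i)"
  have time: "the_enat (time n \<omega>) = ?T n" for n
    unfolding time_def cycle_time_eq[OF assms(2)] by simp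
  have mem: "fst (Y n \<omega>) \<in> carrier G" "snd (Y n \<omega>) \<in> {1..r}" for n
    using Y_mem assms(1) by (auto simp: regular_def)
  then show "position n \<omega> \<in> carrier G" by (simp add: position_def)
  show "position 0 \<omega> = \<one>"
    using assms(1) by (simp add: position_def time regular_def)
  have one: "fst (Y (?T (Suc n)) \<omega>) = fst (Y (?T n) \<omega>) \<otimes> disp (run z0 (cycle (traj \<omega>) n)) \<and>
      snd (Y (?T (Suc n)) \<omega>) = 1" if "snd (Y (?T n) \<omega>) = 1" for n
  proof -
    let ?w = "cycle (traj \<omega>) n" and ?ws = "map (cycle (traj \<omega>)) [0..<n]"
    have acc: "accepts z0 ?w" by (rule accepts_cycle[OF assms(2)])
    have len: "length (concat ?ws) = ?T n"
      by (simp add: length_concat comp_def interv_sum_list_conv_sum_set_nat atLeast0LessThan)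
    have rd: "reads (traj \<omega>) (?ws @ [?w])"
      using recurrent_cycles(2)[OF assms(2), of "Suc n"] by simp
    have "snd (Y (Suc (?T n + i)) \<omega>) = ?w ! i" if "i < length ?w" for i
    proof -
      have "snd (Y (Suc (?T n + i)) \<omega>) = (concat ?ws @ ?w) ! (?T n + i)"
        using rd that len unfolding reads_def by (auto simp del: length_concat)
      also have "\<dots> = ?w ! i"
        by (simp only: len[symmetric] nth_append_length_plus)
      finally show ?thesis .
    qed
    then have "fst (Y (?T n + length ?w) \<omega>) = fst (Y (?T n) \<omega>) \<otimes> disp (run z0 ?w) \<and>
        snd (Y (?T n + length ?w) \<omega>) = col (run z0 ?w)"
      using start that mem acc assms(1) disp_start
      by (intro displacement_run) (auto simp: regular_def)
    moreover have "col (run z0 ?w) = 1"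
      using run_mem[OF acc] start col_final by auto
    ultimately show ?thesis by simp
  qed
  have colour: "snd (Y (?T n) \<omega>) = 1" for n
    by (induction n) (use one assms(1) in \<open>auto simp: regular_def\<close>)
  then show "snd (Y (the_enat (time n \<omega>)) \<omega>) = 1" by (simp only: time)
  show "position (Suc n) \<omega> = position n \<omega> \<otimes> disp (run z0 (cycle (traj \<omega>) n))"
    using one[OF colour] by (simp only: position_def time)
qed

lemma prob_displacement:
  assumes "g \<in> carrier G"
  shows "\<P>(\<omega> in M. disp (run z0 (cycle (traj \<omega>) 0)) = g) = pmf p g"
proof -
  obtain h where h: "\<forall>z\<in>Z. 0 \<le> h z \<and> h z \<le> 1"
    "\<forall>z\<in>Z - F. (\<Sum>c\<in>{1..r}. P (col z) c * h (\<delta> z c)) = h z"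
    "\<forall>z\<in>Z \<inter> F. h z = of_bool (disp z = g)" "h z0 = pmf p g"
    using exit_law[OF assms] by blast
  show ?thesis
    unfolding h(4)[symmetric]
    by (rule prob_run_cycle[where h=h and Q="\<lambda>z. disp z = g"]) (use h(1-3) in blast)+
qed

lemma measurable_position: "position n \<in> M \<rightarrow>\<^sub>M count_space (carrier G)"
  unfolding position_def
proof (rule measurable_compose_countable[OF _ measurable_time])
  fix t
  show "(\<lambda>\<omega>. fst (Y (the_enat t) \<omega>)) \<in> M \<rightarrow>\<^sub>M count_space (carrier G)"
    by (rule measurable_compose[OF Y_measurable]) auto
qed

text \<open>Following \<open>x\<close> means that the displacement of each cycle is the
  corresponding increment of \<open>x\<close>. Independence of the cycles turns this into a product,
  whose factors are given by \<open>prob_displacement\<close>.\<close>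

lemma markov_chain_position: "markov_chain M (carrier G) (conv_kernel G p) \<one> position"
proof (rule markov_chainI_path_prob[OF prob_space_axioms measurable_position])
  show "AE \<omega> in M. position 0 \<omega> = \<one>"
    using AE_regular AE_recurrent by eventually_elim (rule position_eq(2))
  fix n and x :: "nat \<Rightarrow> 'a" assume x: "\<And>i. i \<le> n \<Longrightarrow> x i \<in> carrier G"
  let ?A = "\<lambda>i. {w. disp (run z0 w) = inv (x i) \<otimes> x (Suc i)}"
  have ev: "{\<omega>\<in>space M. \<forall>i\<le>n. position i \<omega> = x i} \<in> events"
  proof -
    have "{\<omega>\<in>space M. position i \<omega> = x i} \<in> events" if "i \<le> n" for i
    proof -
      have "position i -` {x i} \<inter> space M = {\<omega>\<in>space M. position i \<omega> = x i}" by auto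
      with measurable_sets[OF measurable_position, of "{x i}" i] x[OF that] show ?thesis by simp
    qed
    then have "{\<omega>\<in>space M. \<forall>i\<in>{..n}. position i \<omega> = x i} \<in> events"
      by (intro sets.sets_Collect_finite_All') auto
    then show ?thesis by (simp only: Ball_def atMost_iff)
  qed
  have ae: "AE \<omega> in M. (\<forall>i\<le>n. position i \<omega> = x i) \<longleftrightarrow>
      x 0 = \<one> \<and> (\<forall>i<n. cycle (traj \<omega>) i \<in> ?A i)"
    using AE_regular AE_recurrent
  proof eventually_elim
    case (elim \<omega>)
    note pos = position_eq[OF elim]
    have d: "disp (run z0 (cycle (traj \<omega>) i)) \<in> carrier G" for i
      using run_mem[OF accepts_cycle[OF elim(2)], of i] start disp_closed by auto
    have "(\<forall>i\<le>m. position i \<omega> = x i) \<longleftrightarrow> x 0 = \<one> \<and> (\<forall>i<m. cycle (traj \<omega>) i \<in> ?A i)"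
      if "m \<le> n" for m
      using that
    proof (induction m)
      case 0
      then show ?case using pos(2) by auto
    next
      case (Suc m)
      have "(\<forall>i\<le>Suc m. position i \<omega> = x i) \<longleftrightarrow>
          (\<forall>i\<le>m. position i \<omega> = x i) \<and> x m \<otimes> disp (run z0 (cycle (traj \<omega>) m)) = x (Suc m)"
        by (metis le_Suc_eq order_refl pos(3))
      also have "x m \<otimes> disp (run z0 (cycle (traj \<omega>) m)) = x (Suc m) \<longleftrightarrow> cycle (traj \<omega>) m \<in> ?A m"
        using x[of m] x[of "Suc m"] Suc.prems d[of m] by (auto simp: inv_solve_left)
      finally show ?case
        using Suc by (auto simp: less_Suc_eq)
    qed
    then show ?case by simp
  qed
  have "\<P>(\<omega> in M. \<forall>i\<le>n. position i \<omega> = x i) =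
      \<P>(\<omega> in M. x 0 = \<one> \<and> (\<forall>i<n. cycle (traj \<omega>) i \<in> ?A i))"
    by (rule prob_eq_AE[OF ae ev]) measurable
  also have "\<dots> = (if x 0 = \<one> then \<Prod>i<n. \<P>(\<omega> in M. cycle (traj \<omega>) 0 \<in> ?A i) else 0)"
    using cycles_iid[of n ?A] by simp
  also have "(\<Prod>i<n. \<P>(\<omega> in M. cycle (traj \<omega>) 0 \<in> ?A i)) = (\<Prod>i<n. conv_kernel G p (x i) (x (Suc i)))"
    by (rule prod.cong) (use x in \<open>auto simp: conv_kernel_def intro!: prob_displacement\<close>)
  finally show "\<P>(\<omega> in M. \<forall>i\<le>n. position i \<omega> = x i) =
      (if x 0 = \<one> then \<Prod>i<n. conv_kernel G p (x i) (x (Suc i)) else 0)" .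
qed

lemma AE_increment: "AE \<omega> in M. \<forall>n. increment time n \<omega> = real (length (cycle (traj \<omega>) n))"
  using AE_recurrent by eventually_elim (simp add: increment_def time_def cycle_time_eq)

lemma renewal_process_time: "renewal_process M time"
proof -
  have inc [measurable]: "increment time n \<in> borel_measurable M" for n
    unfolding increment_def by measurable
  have eq: "AE \<omega> in M. increment time n \<omega> = real (length (cycle (traj \<omega>) n))" for n
    using AE_increment by eventually_elim simp
  have iid: "\<P>(\<omega> in M. \<forall>i<n. increment time i \<omega> \<in> A i) = (\<Prod>i<n. \<P>(\<omega> in M. increment time 0 \<omega> \<in> A i))"
    if [measurable]: "\<And>i. A i \<in> sets borel" for n and A :: "nat \<Rightarrow> real set"
  proof -
    let ?B = "\<lambda>i. {w. real (length w) \<in> A i}"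
    have "\<P>(\<omega> in M. \<forall>i<n. increment time i \<omega> \<in> A i) = \<P>(\<omega> in M. \<forall>i<n. cycle (traj \<omega>) i \<in> ?B i)"
    proof (rule prob_eq_AE)
      show "AE \<omega> in M. (\<forall>i<n. increment time i \<omega> \<in> A i) \<longleftrightarrow> (\<forall>i<n. cycle (traj \<omega>) i \<in> ?B i)"
        using AE_increment by eventually_elim simp
    qed measurable
    also have "\<dots> = (\<Prod>i<n. \<P>(\<omega> in M. cycle (traj \<omega>) 0 \<in> ?B i))"
      by (rule cycles_iid)
    also have "\<dots> = (\<Prod>i<n. \<P>(\<omega> in M. increment time 0 \<omega> \<in> A i))"
    proof (rule prod.cong[OF refl prob_eq_AE])
      show "AE \<omega> in M. cycle (traj \<omega>) 0 \<in> ?B i \<longleftrightarrow> increment time 0 \<omega> \<in> A i" for i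
        using AE_increment by eventually_elim simp
    qed measurable
    finally show ?thesis .
  qed
  note indep = indep_vars_iidI[where N=borel and X="increment time", OF inc iid]
  have int0: "integrable M (increment time 0)"
  proof (rule integrable_cong_AE_imp[OF integrable_length_cycle inc])
    show "AE \<omega> in M. real (length (cycle (traj \<omega>) 0)) = increment time 0 \<omega>"
      using eq[of 0] by eventually_elim (rule sym)
  qed
  have "integrable M (increment time n)" for n
  proof -
    have "integrable (distr M borel (increment time 0)) (\<lambda>x. x)"
      using int0 by (simp add: integrable_distr_eq)
    then have "integrable (distr M borel (increment time n)) (\<lambda>x. x)"
      by (simp only: indep(2)[of n])
    then show ?thesis by (simp add: integrable_distr_eq)
  qed
  moreover have "AE \<omega> in M. \<forall>n. time n \<omega> < \<infinity> \<and> time n \<omega> < time (Suc n) \<omega>"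
    using AE_recurrent
  proof eventually_elim
    case (elim \<omega>)
    \<comment> \<open>Code words are nonempty since \<open>z0\<close> is not final; this makes the
      times strictly increasing.\<close>
    have "cycle (traj \<omega>) n \<noteq> []" for n
      using accepts_cycle[OF elim, of n] start by auto
    then show ?case by (simp add: time_def cycle_time_eq[OF elim])
  qed
  ultimately show ?thesis
    unfolding renewal_process_def using indep by blast
qed

lemma linearizing_times: "linearizing_times G r p M Y time"
  unfolding linearizing_times_def
proof (intro conjI allI ballI stopping_time_time renewal_process_time)
  show "time 0 \<omega> = 0" for \<omega>
    by (simp add: time_def)
  show "AE \<omega> in M. \<forall>n. snd (Y (the_enat (time n \<omega>)) \<omega>) = 1"
    using AE_regular AE_recurrent by eventually_elim (use position_eq(1) in blast)
  show "markov_chain M (carrier G) (conv_kernel G p) \<one> (\<lambda>n \<omega>. fst (Y (the_enat (time n \<omega>)) \<omega>))"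
    using markov_chain_position by (simp add: position_def[abs_def])
qed

end

context labelled_excursions
begin

lemma linearizes: "linearizes G S r walk p"
  unfolding linearizes_def
proof (intro conjI allI impI coloured_walk quasi_irreducible nearest_neighbour markov_chain_exists)
  fix M :: "(nat \<Rightarrow> 'a \<times> nat) measure" and Y
  assume "markov_chain M states (coloured_kernel G walk) (\<one>, 1) Y"
  then interpret walk_realization G r P Z F \<delta> col L z0 S p lab disp M Y
    by unfold_locales
  show "\<exists>\<tau>. linearizing_times G r p M Y \<tau>"
    using linearizing_times by blast
qed

end

section \<open>The network of loops\<close>

text \<open>The states of the automaton. \<open>Start\<close> and \<open>Finish\<close> both lie
  over the root: a return to the entry side resets to \<open>Start\<close>, a traversal ends the
  word.\<close>

datatype 'a phase = Start | Inside 'a nat bool | Finish 'a bool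

text \<open>
  The colours are a root \<open>None\<close> and, for every \<open>g\<close> in the support of \<open>p\<close>, the interior vertices
  \<open>Some (g, i)\<close>, \<open>0 < i < k g\<close>, of a loop at the root that carries the path \<open>x g\<close> from \<open>\<one>\<close> to \<open>g\<close>
  in the Cayley graph. Inside a loop the walk is a simple random walk, and a loop is entered at its
  near end with probability proportional to \<open>(1 - \<beta>) * k g * pmf p g\<close> and at its far end with
  probability proportional to \<open>\<beta> * k g * pmf p g\<close>. The factor \<open>k g\<close> compensates the probability
  \<open>1 / k g\<close> of traversing the loop before returning to the entry side. The loops have length at
  least 3, so that the two ends are different colours.
\<close>

locale loop_network = group G for G :: "('a, 'b) monoid_scheme" (structure) +
  fixes S :: "'a set" and p :: "'a pmf" and k :: "'a \<Rightarrow> nat" and x :: "'a \<Rightarrow> nat \<Rightarrow> 'a"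
    and \<beta> :: real and r :: nat and dec :: "nat \<Rightarrow> ('a \<times> nat) option"
  assumes countable_carrier: "countable (carrier G)"
    and S_closed: "S \<subseteq> carrier G" and S_inv: "s \<in> S \<Longrightarrow> inv s \<in> S"
    and finite_support: "finite (set_pmf p)" and support_closed: "set_pmf p \<subseteq> carrier G"
    and support_generate: "generate G (set_pmf p) = carrier G"
    and k_ge_3: "g \<in> set_pmf p \<Longrightarrow> k g \<ge> 3"
    and x_0: "g \<in> set_pmf p \<Longrightarrow> x g 0 = \<one>" and x_k: "g \<in> set_pmf p \<Longrightarrow> x g (k g) = g"
    and x_closed: "g \<in> set_pmf p \<Longrightarrow> x g i \<in> carrier G"
    and x_step: "g \<in> set_pmf p \<Longrightarrow> i < k g \<Longrightarrow> inv (x g i) \<otimes> x g (Suc i) \<in> S"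
    and \<beta>: "0 \<le> \<beta>" "\<beta> < 1"
    and balance: "g \<in> carrier G \<Longrightarrow> (1 - \<beta>) * pmf p g + \<beta> * pmf p (inv g) = pmf p g"
    and dec: "bij_betw dec {1..r} (insert None (Some ` (SIGMA g:set_pmf p. {1..<k g})))"
    and dec_1: "dec 1 = None" and r: "1 \<le> r"
begin

abbreviation vertices :: "('a \<times> nat) set" where
  "vertices \<equiv> SIGMA g:set_pmf p. {1..<k g}"

abbreviation colours :: "('a \<times> nat) option set" where
  "colours \<equiv> insert None (Some ` vertices)"

text \<open>The mean loop length. Its inverse is the probability that an excursion from the root
  traverses its loop, since \<open>enter g\<close> divided by \<open>k g\<close> sums to
  \<open>1 / K\<close>.\<close>

definition K :: real where
  "K = (\<Sum>g\<in>set_pmf p. real (k g) * pmf p g)"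

definition enter :: "'a \<Rightarrow> real" where
  "enter g = real (k g) * pmf p g / K"

fun nxt :: "'a \<times> nat \<Rightarrow> ('a \<times> nat) option" where
  "nxt (g, i) = (if Suc i = k g then None else Some (g, Suc i))"

fun prv :: "'a \<times> nat \<Rightarrow> ('a \<times> nat) option" where
  "prv (g, i) = (if i = 1 then None else Some (g, i - 1))"

fun trans_prob :: "('a \<times> nat) option \<Rightarrow> ('a \<times> nat) option \<Rightarrow> real" where
  "trans_prob None None = 0"
| "trans_prob None (Some (g, i)) =
    enter g * ((1 - \<beta>) * of_bool (i = 1) + \<beta> * of_bool (i = k g - 1))"
| "trans_prob (Some v) c = (of_bool (c = nxt v) + of_bool (c = prv v)) / 2"

text \<open>The root stands for both endpoints of every path: a step at the near end is measured
  from the identity, a step at the far end from \<open>g\<close>. With this convention reversing a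
  step inverts its label (\<open>label_inv\<close>).\<close>

fun label :: "('a \<times> nat) option \<Rightarrow> ('a \<times> nat) option \<Rightarrow> 'a" where
  "label None None = \<one>"
| "label None (Some (g, i)) = (if i = 1 then x g 1 else inv g \<otimes> x g i)"
| "label (Some (g, i)) None = (if i = 1 then inv (x g 1) else inv (x g i) \<otimes> g)"
| "label (Some (g, i)) (Some (h, j)) = inv (x g i) \<otimes> x h j"

text \<open>The Boolean records the entry side: \<open>True\<close> for the near end, where \<open>x g 1\<close> is.\<close>

fun move :: "'a phase \<Rightarrow> ('a \<times> nat) option \<Rightarrow> 'a phase" where
  "move (Inside g i d) None = (if (if d then Suc i = k g else i = 1) then Finish g d else Start)"
| "move (Inside g i d) (Some (h, j)) = Inside h j d"
| "move _ None = Start"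
| "move _ (Some (g, i)) = Inside g i (i = 1)"

fun colour :: "'a phase \<Rightarrow> ('a \<times> nat) option" where
  "colour (Inside g i d) = Some (g, i)"
| "colour _ = None"

text \<open>After an entrance at the far end the path is run backwards from \<open>g\<close>, hence
  the factor \<open>inv g\<close> and the total displacement \<open>inv g\<close>.\<close>

fun shift :: "'a phase \<Rightarrow> 'a" where
  "shift Start = \<one>"
| "shift (Inside g i d) = (if d then x g i else inv g \<otimes> x g i)"
| "shift (Finish g d) = (if d then g else inv g)"

definition final :: "'a phase set" where
  "final = (\<lambda>(g, d). Finish g d) ` (set_pmf p \<times> UNIV)"

definition phases :: "'a phase set" where
  "phases = insert Start (final \<union> (\<lambda>((g, i), d). Inside g i d) ` (vertices \<times> UNIV))"

definition enc :: "('a \<times> nat) option \<Rightarrow> nat" where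
  "enc = inv_into {1..r} dec"

lemma enc_mem: "c \<in> colours \<Longrightarrow> enc c \<in> {1..r}"
  unfolding enc_def using dec by (metis bij_betw_imp_surj_on inv_into_into)

lemma dec_enc: "c \<in> colours \<Longrightarrow> dec (enc c) = c"
  unfolding enc_def using dec by (metis bij_betw_inv_into_right)

lemma dec_mem: "u \<in> {1..r} \<Longrightarrow> dec u \<in> colours"
  using dec by (rule bij_betw_apply)

lemma enc_dec: "u \<in> {1..r} \<Longrightarrow> enc (dec u) = u"
  unfolding enc_def using dec by (rule bij_betw_inv_into_left)

lemma enc_None: "enc None = 1"
  using enc_dec[of 1] dec_1 r by simp

lemma phases_cases:
  assumes "z \<in> phases"
  obtains "z = Start" | g i d where "z = Inside g i d" "g \<in> set_pmf p" "1 \<le> i" "i < k g"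
    | g d where "z = Finish g d" "g \<in> set_pmf p"
  using assms unfolding phases_def final_def by fastforce

lemma not_final_cases:
  assumes "z \<in> phases - final"
  obtains "z = Start" | g i d where "z = Inside g i d" "g \<in> set_pmf p" "1 \<le> i" "i < k g"
  using assms unfolding phases_def final_def by fastforce

lemma phasesI:
  "Start \<in> phases" "g \<in> set_pmf p \<Longrightarrow> Finish g d \<in> phases"
  "g \<in> set_pmf p \<Longrightarrow> 1 \<le> i \<Longrightarrow> i < k g \<Longrightarrow> Inside g i d \<in> phases"
  unfolding phases_def final_def by force+

lemma colour_mem: "z \<in> phases \<Longrightarrow> colour z \<in> colours"
  by (erule phases_cases) auto

lemma colours_cases:
  assumes "c \<in> colours"
  obtains "c = None" | g i where "c = Some (g, i)" "g \<in> set_pmf p" "1 \<le> i" "i < k g"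
  using assms by auto

lemma pmf_sum: "(\<Sum>g\<in>set_pmf p. pmf p g) = 1"
  using finite_support by (intro sum_pmf_eq_1) auto

lemma K_pos: "K > 0"
proof -
  have "1 = (\<Sum>g\<in>set_pmf p. pmf p g)" by (simp add: pmf_sum)
  also have "\<dots> \<le> K"
    unfolding K_def
  proof (rule sum_mono)
    fix g assume "g \<in> set_pmf p"
    then have "1 * pmf p g \<le> real (k g) * pmf p g"
      using k_ge_3[of g] by (intro mult_right_mono) auto
    then show "pmf p g \<le> real (k g) * pmf p g" by simp
  qed
  finally show ?thesis by simp
qed

lemma enter_nonneg: "enter g \<ge> 0"
  using K_pos by (simp add: enter_def)

lemma enter_pos: "g \<in> set_pmf p \<Longrightarrow> enter g > 0"
  using K_pos k_ge_3[of g] by (auto simp: enter_def pmf_positive_iff intro!: divide_pos_pos mult_pos_pos)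

lemma enter_sum: "(\<Sum>g\<in>set_pmf p. enter g) = 1"
  using K_pos unfolding enter_def sum_divide_distrib[symmetric] by (simp add: K_def)

lemma trans_prob_nonneg: "trans_prob u v \<ge> 0"
  using enter_nonneg \<beta> by (cases "(u, v)" rule: trans_prob.cases) auto

lemma sum_trans_root:
  "(\<Sum>c\<in>colours. trans_prob None c * f c) =
    (\<Sum>g\<in>set_pmf p. enter g * ((1 - \<beta>) * f (Some (g, 1)) + \<beta> * f (Some (g, k g - 1))))"
proof -
  have "(\<Sum>c\<in>colours. trans_prob None c * f c) = (\<Sum>v\<in>vertices. trans_prob None (Some v) * f (Some v))"
    using finite_support by (subst sum.insert) (auto simp: sum.reindex)
  also have "\<dots> = (\<Sum>g\<in>set_pmf p. \<Sum>i\<in>{1..<k g}. trans_prob None (Some (g, i)) * f (Some (g, i)))"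
    using finite_support by (subst sum.Sigma) (auto simp: split_def simp del: trans_prob.simps)
  also have "\<dots> = (\<Sum>g\<in>set_pmf p. enter g * ((1 - \<beta>) * f (Some (g, 1)) + \<beta> * f (Some (g, k g - 1))))"
  proof (rule sum.cong)
    fix g assume g: "g \<in> set_pmf p"
    have "(\<Sum>i\<in>{1..<k g}. trans_prob None (Some (g, i)) * f (Some (g, i))) =
        (\<Sum>i\<in>{1..<k g}. if i = 1 then enter g * (1 - \<beta>) * f (Some (g, i)) else 0) +
        (\<Sum>i\<in>{1..<k g}. if i = k g - 1 then enter g * \<beta> * f (Some (g, i)) else 0)"
      unfolding sum.distrib[symmetric] by (rule sum.cong) (auto simp: algebra_simps)
    also have "\<dots> = enter g * ((1 - \<beta>) * f (Some (g, 1)) + \<beta> * f (Some (g, k g - 1)))"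
      using k_ge_3[OF g] by (simp add: algebra_simps)
    finally show "(\<Sum>i\<in>{1..<k g}. trans_prob None (Some (g, i)) * f (Some (g, i))) =
        enter g * ((1 - \<beta>) * f (Some (g, 1)) + \<beta> * f (Some (g, k g - 1)))" .
  qed simp
  finally show ?thesis .
qed

lemma nxt_prv_mem:
  "g \<in> set_pmf p \<Longrightarrow> 1 \<le> i \<Longrightarrow> i < k g \<Longrightarrow> nxt (g, i) \<in> colours \<and> prv (g, i) \<in> colours"
  by (auto intro!: imageI)

lemma sum_trans_inside:
  assumes "g \<in> set_pmf p" "1 \<le> i" "i < k g"
  shows "(\<Sum>c\<in>colours. trans_prob (Some (g, i)) c * f c) = (f (nxt (g, i)) + f (prv (g, i))) / 2"
proof -
  have fin: "finite colours" using finite_support by auto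
  have "(\<Sum>c\<in>colours. trans_prob (Some (g, i)) c * f c) =
      (\<Sum>c\<in>colours. if c = nxt (g, i) then f c / 2 else 0) +
      (\<Sum>c\<in>colours. if c = prv (g, i) then f c / 2 else 0)"
    unfolding sum.distrib[symmetric] by (rule sum.cong) (auto simp: add_divide_distrib)
  also have "\<dots> = (f (nxt (g, i)) + f (prv (g, i))) / 2"
    using nxt_prv_mem[OF assms] by (simp only: sum.delta'[OF fin] sum.delta[OF fin] if_True add_divide_distrib)
  finally show ?thesis .
qed

lemma sum_dec: "(\<Sum>c\<in>{1..r}. f (dec c)) = (\<Sum>c\<in>colours. f c)"
  by (rule sum.reindex_bij_betw[OF dec])

text \<open>
  On the loop of \<open>g\<close>, the profile interpolates between the values at the two ends; the quadratic
  term is the mean exit time of simple random walk.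
\<close>

fun profile :: "real \<Rightarrow> real \<Rightarrow> ('a \<Rightarrow> bool \<Rightarrow> real) \<Rightarrow> 'a phase \<Rightarrow> real" where
  "profile c a b Start = a"
| "profile c a b (Inside g i d) =
    (if d then real (k g - i) / real (k g) * a + real i / real (k g) * b g d
     else real i / real (k g) * a + real (k g - i) / real (k g) * b g d) + c * real i * real (k g - i)"
| "profile c a b (Finish g d) = b g d"

text \<open>The linear part is harmonic, and averaging i (k - i) over the two neighbours lowers it
  by exactly 1. At the ends of the loop the same formula returns the values at \<open>Start\<close>
  and \<open>Finish\<close>. The choice c = 1 yields the Lyapunov function, c = 0 the harmonic
  one.\<close>

lemma profile_inside:
  assumes g: "g \<in> set_pmf p" and i: "1 \<le> i" "i < k g"
  shows "c + (\<Sum>v\<in>colours. trans_prob (Some (g, i)) v * profile c a b (move (Inside g i d) v)) =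
    profile c a b (Inside g i d)"
proof -
  obtain j where j: "i = Suc j" using i by (cases i) auto
  obtain m where m: "k g = Suc i + m" using i by (metis Suc_leI le_iff_add)
  define N :: real where "N = real (k g)"
  have N: "N = real j + real m + 2" "N > 0" by (simp_all add: N_def m j)
  have up: "profile c a b (move (Inside g i d) (nxt (g, i))) =
      (if d then real m / N * a + real (Suc i) / N * b g d
       else real (Suc i) / N * a + real m / N * b g d) + c * real (Suc i) * real m"
    using k_ge_3[OF g] N(2) by (auto simp: m N_def)
  have down: "profile c a b (move (Inside g i d) (prv (g, i))) =
      (if d then real (m + 2) / N * a + real j / N * b g d
       else real j / N * a + real (m + 2) / N * b g d) + c * real j * real (m + 2)"
    using k_ge_3[OF g] N(2) by (auto simp: m j N_def divide_simps)
  have here: "profile c a b (Inside g i d) =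
      (if d then real (m + 1) / N * a + real i / N * b g d
       else real i / N * a + real (m + 1) / N * b g d) + c * real i * real (m + 1)"
    by (simp add: m N_def)
  show ?thesis
    unfolding sum_trans_inside[OF g i] up down here
    using N(2) by (auto simp: j field_simps)
qed

text \<open>After an entrance at either side the value \<open>b\<close> has weight
  \<open>1 / k g\<close>, which cancels the factor \<open>k g\<close> in \<open>enter g\<close> and
  leaves \<open>pmf p g / K\<close>. The quadratic term is \<open>k g - 1\<close> at both
  ends.\<close>

lemma profile_start:
  "(\<Sum>v\<in>colours. trans_prob None v * profile c a b (move Start v)) =
    a * (1 - 1 / K) + (\<Sum>g\<in>set_pmf p. pmf p g * ((1 - \<beta>) * b g True + \<beta> * b g False)) / K +
    c * (\<Sum>g\<in>set_pmf p. enter g * real (k g - 1))"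
proof -
  have "(\<Sum>v\<in>colours. trans_prob None v * profile c a b (move Start v)) =
     (\<Sum>g\<in>set_pmf p. enter g * a - pmf p g * a / K +
        pmf p g * ((1 - \<beta>) * b g True + \<beta> * b g False) / K + c * (enter g * real (k g - 1)))"
    unfolding sum_trans_root
  proof (rule sum.cong)
    fix g assume g: "g \<in> set_pmf p"
    obtain m where m: "k g = m + 3" using k_ge_3[OF g] by (metis add.commute le_iff_add)
    define N :: real where "N = real (k g)"
    have N: "N > 0" "real m = N - 3" by (simp_all add: N_def m)
    have 1: "profile c a b (move Start (Some (g, 1))) = (N - 1) / N * a + b g True / N + c * (N - 1)"
      "profile c a b (move Start (Some (g, k g - 1))) = (N - 1) / N * a + b g False / N + c * (N - 1)"
      by (simp_all add: m N_def)
    have 2: "real (k g - 1) = N - 1" by (simp add: m N_def)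
    have "enter g * ((1 - \<beta>) * ((N - 1) / N * a + b g True / N + c * (N - 1)) +
          \<beta> * ((N - 1) / N * a + b g False / N + c * (N - 1))) =
        enter g * a - enter g / N * a + enter g / N * ((1 - \<beta>) * b g True + \<beta> * b g False) +
        c * (enter g * (N - 1))"
      using N by (simp add: field_simps)
    also have "enter g / N = pmf p g / K"
      using N by (simp add: enter_def N_def)
    finally show "enter g * ((1 - \<beta>) * profile c a b (move Start (Some (g, 1))) +
          \<beta> * profile c a b (move Start (Some (g, k g - 1)))) =
        enter g * a - pmf p g * a / K +
        pmf p g * ((1 - \<beta>) * b g True + \<beta> * b g False) / K + c * (enter g * real (k g - 1))"
      unfolding 1 2 by simp
  qed simp
  also have "\<dots> = (\<Sum>g\<in>set_pmf p. enter g) * a - (\<Sum>g\<in>set_pmf p. pmf p g) * a / K +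
      (\<Sum>g\<in>set_pmf p. pmf p g * ((1 - \<beta>) * b g True + \<beta> * b g False)) / K +
      c * (\<Sum>g\<in>set_pmf p. enter g * real (k g - 1))"
    by (simp add: sum.distrib sum_subtractf sum_distrib_left sum_distrib_right sum_divide_distrib)
  also have "\<dots> = a * (1 - 1 / K) + (\<Sum>g\<in>set_pmf p. pmf p g * ((1 - \<beta>) * b g True + \<beta> * b g False)) / K +
      c * (\<Sum>g\<in>set_pmf p. enter g * real (k g - 1))"
    by (simp add: enter_sum pmf_sum algebra_simps)
  finally show ?thesis .
qed

text \<open>The law of the displacement of a traversal: a near entrance contributes
  \<open>g\<close>, a far one \<open>inv g\<close>. The assumption \<open>balance\<close> says
  precisely that this mixture is \<open>p\<close>.\<close>

lemma exit_weight:
  assumes "h \<in> carrier G"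
  shows "(\<Sum>g\<in>set_pmf p. pmf p g * ((1 - \<beta>) * of_bool (g = h) + \<beta> * of_bool (inv g = h))) = pmf p h"
proof -
  have eq: "inv g = h \<longleftrightarrow> g = inv h" if "g \<in> set_pmf p" for g
    using that assms support_closed by (metis inv_inv subsetD)
  have "(\<Sum>g\<in>set_pmf p. pmf p g * ((1 - \<beta>) * of_bool (g = h) + \<beta> * of_bool (inv g = h))) =
     (\<Sum>g\<in>set_pmf p. if g = h then (1 - \<beta>) * pmf p g else 0) +
     (\<Sum>g\<in>set_pmf p. if g = inv h then \<beta> * pmf p g else 0)"
    unfolding sum.distrib[symmetric] by (rule sum.cong) (auto simp: eq algebra_simps)
  also have "\<dots> = (1 - \<beta>) * pmf p h + \<beta> * pmf p (inv h)"
    using finite_support by (simp add: set_pmf_iff)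
  finally show ?thesis using balance[OF assms] by simp
qed

definition transition :: "nat \<Rightarrow> nat \<Rightarrow> real" where
  "transition u v = trans_prob (dec u) (dec v)"

text \<open>The root value \<open>a\<close> solving a = 1 + a (1 - 1 / K) + s, where s is the sum in
  the definition; this is the drift condition at \<open>Start\<close> with equality.\<close>

definition L0 :: real where
  "L0 = K * (1 + (\<Sum>g\<in>set_pmf p. enter g * real (k g - 1)))"

lemma L0_nonneg: "L0 \<ge> 0"
  unfolding L0_def using K_pos enter_nonneg
  by (intro mult_nonneg_nonneg add_nonneg_nonneg sum_nonneg) auto

lemma label_closed: "u \<in> colours \<Longrightarrow> v \<in> colours \<Longrightarrow> label u v \<in> carrier G"
  using x_closed support_closed
  by (elim colours_cases) (auto simp: subset_iff)

lemma label_inv: "u \<in> colours \<Longrightarrow> v \<in> colours \<Longrightarrow> label v u = inv (label u v)"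
  using x_closed support_closed
  by (elim colours_cases) (auto simp: subset_iff inv_mult_group)

lemma label_S:
  assumes "u \<in> colours" "v \<in> colours" "trans_prob u v > 0"
  shows "label u v \<in> S"
proof -
  have near: "x g 1 \<in> S" if "g \<in> set_pmf p" for g
    using x_step[OF that, of 0] k_ge_3[OF that] x_0[OF that] x_closed[OF that, of 1] by simp
  have far: "inv (x g i) \<otimes> g \<in> S" if "g \<in> set_pmf p" "Suc i = k g" for g i
    using x_step[OF that(1), of i] that x_k[of g] by simp
  have far': "inv g \<otimes> x g i \<in> S" if "g \<in> set_pmf p" "Suc i = k g" for g i
    using S_inv[OF far[OF that]] that x_closed support_closed by (auto simp: inv_mult_group)
  have down: "inv (x g (Suc i)) \<otimes> x g i \<in> S" if "g \<in> set_pmf p" "i < k g" for g i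
    using S_inv[OF x_step[OF that]] that x_closed by (simp add: inv_mult_group)
  from assms(1) show ?thesis
  proof (cases rule: colours_cases)
    case u: 1
    from assms(2) show ?thesis
    proof (cases rule: colours_cases)
      case 1
      with u assms(3) show ?thesis by simp
    next
      case (2 g i)
      with u assms(3) have "i = 1 \<or> Suc i = k g"
        by (auto simp: of_bool_def split: if_splits)
      with u 2 near far' show ?thesis by auto
    qed
  next
    case u: (2 g i)
    then have v: "v = nxt (g, i) \<or> v = prv (g, i)"
      using assms(3) by (auto simp: of_bool_def split: if_splits)
    from assms(2) show ?thesis
    proof (cases rule: colours_cases)
      case 1
      with v have "Suc i = k g \<or> i = 1" by (auto split: if_splits)
      with u 1 far S_inv near show ?thesis by auto
    next
      case (2 h j)
      with v have "h = g \<and> (j = Suc i \<or> i = Suc j)"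
        using u by (auto split: if_splits)
      with u 2 down x_step show ?thesis by auto
    qed
  qed
qed

text \<open>Labels telescope along a loop. An exit at the entry side gives the identity, so
  resetting to \<open>Start\<close> loses no displacement.\<close>

lemma shift_move:
  assumes z: "z \<in> phases - final" and v: "v \<in> colours" and pos: "trans_prob (colour z) v > 0"
  shows "shift (move z v) = shift z \<otimes> label (colour z) v"
  using z
proof (cases rule: not_final_cases)
  case 1
  with v pos x_closed support_closed show ?thesis
    by (elim colours_cases) auto
next
  case z: (2 g i d)
  have mem: "g \<in> carrier G" "\<And>j. x g j \<in> carrier G"
    using z x_closed support_closed by auto
  have cancel: "a \<otimes> b \<otimes> (inv b \<otimes> c) = a \<otimes> c" if "a \<in> carrier G" "b \<in> carrier G" "c \<in> carrier G" for a b c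
    using that by (metis inv_closed inv_solve_left m_assoc m_closed)
  have v': "v = nxt (g, i) \<or> v = prv (g, i)"
    using pos z by (auto simp: of_bool_def split: if_splits)
  from v show ?thesis
  proof (cases rule: colours_cases)
    case 1
    with v' have "Suc i = k g \<or> i = 1" by (auto split: if_splits)
    then show ?thesis
      using z 1 mem k_ge_3[OF z(2)] cancel[of "\<one>" "x g i" g] cancel[of "inv g" "x g i" g]
      by (auto simp: m_assoc)
  next
    case (2 h j)
    with v' have "h = g" using z by (auto split: if_splits)
    then show ?thesis
      using z 2 mem cancel[of "\<one>" "x g i" "x g j"] cancel[of "inv g" "x g i" "x g j"] by auto
  qed
qed

lemma move_mem:
  assumes z: "z \<in> phases - final" and v: "v \<in> colours"
  shows "move z v \<in> phases \<and> colour (move z v) = v"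
  using z
proof (cases rule: not_final_cases)
  case 1
  with v show ?thesis by (elim colours_cases) (auto intro: phasesI)
next
  case (2 g i d)
  with v show ?thesis by (elim colours_cases) (auto intro: phasesI)
qed

lemma transition_enc: "u \<in> colours \<Longrightarrow> v \<in> colours \<Longrightarrow> transition (enc u) (enc v) = trans_prob u v"
  by (simp add: transition_def dec_enc)

text \<open>The near end is entered with positive probability because \<beta> < 1; from there the
  vertices are climbed one by one.\<close>

lemma reach_vertex:
  assumes g: "g \<in> set_pmf p" and i: "1 \<le> i" "i < k g"
  shows "(1, enc (Some (g, i))) \<in>
    {(a, b). a \<in> {1..r} \<and> b \<in> {1..r} \<and> transition a b > 0}\<^sup>+" (is "_ \<in> ?R\<^sup>+")
  using i
proof (induction i rule: dec_induct)
  case base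
  have mem: "Some (g, 1) \<in> colours" "None \<in> colours"
    using g k_ge_3[OF g] by auto
  have "trans_prob None (Some (g, 1)) > 0"
    using enter_pos[OF g] \<beta> k_ge_3[OF g] by auto
  then have "(enc None, enc (Some (g, 1))) \<in> ?R"
    using enc_mem[OF mem(1)] enc_mem[OF mem(2)] transition_enc[OF mem(2,1)] by simp
  then show ?case by (auto simp: enc_None)
next
  case (step i)
  have mem: "Some (g, i) \<in> colours" "Some (g, Suc i) \<in> colours"
    using g step by auto
  have "trans_prob (Some (g, i)) (Some (g, Suc i)) > 0"
    using step by auto
  then have "(enc (Some (g, i)), enc (Some (g, Suc i))) \<in> ?R"
    using enc_mem[OF mem(1)] enc_mem[OF mem(2)] transition_enc[OF mem(1,2)] by simp
  with step show ?case by (meson Suc_lessD trancl.trancl_into_trancl)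
qed

lemma reach_root:
  assumes g: "g \<in> set_pmf p" and i: "1 \<le> i" "i < k g"
  shows "(enc (Some (g, i)), 1) \<in>
    {(a, b). a \<in> {1..r} \<and> b \<in> {1..r} \<and> transition a b > 0}\<^sup>+" (is "_ \<in> ?R\<^sup>+")
  using i
proof (induction i rule: dec_induct)
  case base
  have mem: "Some (g, 1) \<in> colours" "None \<in> colours"
    using g k_ge_3[OF g] by auto
  have "trans_prob (Some (g, 1)) None > 0"
    by auto
  then have "(enc (Some (g, 1)), enc None) \<in> ?R"
    using enc_mem[OF mem(1)] enc_mem[OF mem(2)] transition_enc[OF mem(1,2)] by simp
  then show ?case by (auto simp: enc_None)
next
  case (step i)
  have mem: "Some (g, i) \<in> colours" "Some (g, Suc i) \<in> colours"
    using g step by auto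
  have "trans_prob (Some (g, Suc i)) (Some (g, i)) > 0"
    using step by auto
  then have "(enc (Some (g, Suc i)), enc (Some (g, i))) \<in> ?R"
    using enc_mem[OF mem(1)] enc_mem[OF mem(2)] transition_enc[OF mem(2,1)] by simp
  with step show ?case by (meson Suc_lessD trancl_into_trancl2)
qed

lemma irreducible_transition: "irreducible_matrix r transition"
  unfolding irreducible_matrix_def
proof (intro ballI)
  let ?R = "{(a, b). a \<in> {1..r} \<and> b \<in> {1..r} \<and> transition a b > 0}"
  obtain g where g: "g \<in> set_pmf p"
    using set_pmf_not_empty[of p] by auto
  have 11: "(1, 1) \<in> ?R\<^sup>+"
    using trancl_trans[OF reach_vertex[OF g, of 1] reach_root[OF g, of 1]] k_ge_3[OF g] by simp
  have to: "(u, 1) \<in> ?R\<^sup>+" and fro: "(1, u) \<in> ?R\<^sup>+" if "u \<in> {1..r}" for u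
  proof -
    from dec_mem[OF that] have "(u, 1) \<in> ?R\<^sup>+ \<and> (1, u) \<in> ?R\<^sup>+"
    proof (cases rule: colours_cases)
      case 1
      then have "u = 1" using enc_dec[OF that] enc_None by simp
      with 11 show ?thesis by simp
    next
      case (2 g i)
      then have "enc (Some (g, i)) = u" using enc_dec[OF that] by simp
      with reach_vertex[OF 2(2-4)] reach_root[OF 2(2-4)] show ?thesis by simp
    qed
    then show "(u, 1) \<in> ?R\<^sup>+" "(1, u) \<in> ?R\<^sup>+" by simp_all
  qed
  fix u v assume "u \<in> {1..r}" "v \<in> {1..r}"
  then show "(u, v) \<in> ?R\<^sup>+"
    using to fro by (meson trancl_trans)
qed

text \<open>The labels along the loop of \<open>g\<close> multiply to \<open>g\<close>, so the
  subgroup they generate contains the support of \<open>p\<close>.\<close>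

lemma labels_generate:
  "generate G {label (dec u) (dec v) | u v. u \<in> {1..r} \<and> v \<in> {1..r} \<and> transition u v > 0} = carrier G"
  (is "generate G ?T = _")
proof
  have T: "?T \<subseteq> carrier G"
  proof safe
    fix u v assume "u \<in> {1..r}" "v \<in> {1..r}"
    then show "label (dec u) (dec v) \<in> carrier G"
      by (intro label_closed dec_mem)
  qed
  then show "generate G ?T \<subseteq> carrier G"
    by (rule generate_incl)
  interpret H: subgroup "generate G ?T" G
    by (rule generate_is_subgroup[OF T])
  have inT: "label u v \<in> generate G ?T" if "u \<in> colours" "v \<in> colours" "trans_prob u v > 0" for u v
  proof (rule generate.incl)
    have "label u v = label (dec (enc u)) (dec (enc v))"
      using that by (simp add: dec_enc)
    moreover have "transition (enc u) (enc v) > 0"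
      using that by (simp add: transition_enc)
    ultimately show "label u v \<in> ?T"
      using enc_mem[OF that(1)] enc_mem[OF that(2)] by (intro CollectI exI conjI) assumption+
  qed
  have "set_pmf p \<subseteq> generate G ?T"
  proof
    fix g assume g: "g \<in> set_pmf p"
    have mem: "g \<in> carrier G" "\<And>j. x g j \<in> carrier G"
      using g x_closed support_closed by auto
    have x_mem: "x g i \<in> generate G ?T" if "1 \<le> i" "i < k g" for i
      using that
    proof (induction i rule: dec_induct)
      case base
      have "label None (Some (g, 1)) \<in> generate G ?T"
        using g enter_pos[OF g] \<beta> k_ge_3[OF g] by (intro inT) auto
      then show ?case by simp
    next
      case (step i)
      have "label (Some (g, i)) (Some (g, Suc i)) \<in> generate G ?T"
        using g step by (intro inT) auto
      moreover have "x g i \<in> generate G ?T"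
        using step.IH step.hyps step.prems by (simp only: Suc_lessD)
      ultimately have "x g i \<otimes> (inv (x g i) \<otimes> x g (Suc i)) \<in> generate G ?T"
        unfolding label.simps by (rule H.m_closed[rotated])
      moreover have "x g i \<otimes> (inv (x g i) \<otimes> x g (Suc i)) = x g (Suc i)"
        using mem by (metis inv_closed inv_solve_left m_closed)
      ultimately show ?case by simp
    qed
    let ?i = "k g - 1"
    have i: "1 \<le> ?i" "?i < k g" "?i \<noteq> 1" using k_ge_3[OF g] by auto
    have "label (Some (g, ?i)) None \<in> generate G ?T"
      using g i by (intro inT) auto
    then have "inv (x g ?i) \<otimes> g \<in> generate G ?T"
      unfolding label.simps using i(3) by (simp only: if_False)
    then have "x g ?i \<otimes> (inv (x g ?i) \<otimes> g) \<in> generate G ?T"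
      by (rule H.m_closed[OF x_mem[OF i(1,2)]])
    moreover have "x g ?i \<otimes> (inv (x g ?i) \<otimes> g) = g"
      using mem by (metis inv_closed inv_solve_left m_closed)
    ultimately show "g \<in> generate G ?T" by simp
  qed
  then show "carrier G \<subseteq> generate G ?T"
    unfolding support_generate[symmetric] by (rule generate_subgroup_incl[OF _ H.subgroup_axioms])
qed

end

text \<open>The Lyapunov function vanishes at \<open>Finish\<close> and is the mean remaining
  reading time; the witnesses for \<open>exit_law\<close> come from the same profile without
  quadratic term.\<close>

sublocale loop_network \<subseteq> labelled_excursions G r transition phases final
  "\<lambda>z c. move z (dec c)" "\<lambda>z. enc (colour z)" "profile 1 L0 (\<lambda>_ _. 0)" Start S p
  "\<lambda>u v. label (dec u) (dec v)" shift
proof unfold_locales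
  show "(\<Sum>v\<in>{1..r}. transition u v) = 1" if "u \<in> {1..r}" for u
  proof -
    have "(\<Sum>v\<in>{1..r}. transition u v) = (\<Sum>v\<in>colours. trans_prob (dec u) v * 1)"
      unfolding transition_def by (subst sum_dec) simp
    also have "\<dots> = 1"
      using dec_mem[OF that]
    proof (cases rule: colours_cases)
      case 1
      then show ?thesis by (simp only: sum_trans_root) (simp add: enter_sum)
    next
      case (2 g i)
      then show ?thesis by (simp only: sum_trans_inside[OF 2(2-4)]) simp
    qed
    finally show ?thesis .
  qed
next
  fix z assume z: "z \<in> phases - final"
  have sum_eq: "(\<Sum>c\<in>{1..r}. transition (enc (colour z)) c * f (move z (dec c))) =
      (\<Sum>v\<in>colours. trans_prob (colour z) v * f (move z v))" for f :: "'a phase \<Rightarrow> real"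
    using z colour_mem[of z] unfolding transition_def
    by (subst sum_dec[symmetric]) (simp add: dec_enc)
  show "1 + (\<Sum>c\<in>{1..r}. transition (enc (colour z)) c * profile 1 L0 (\<lambda>_ _. 0) (move z (dec c)))
      \<le> profile 1 L0 (\<lambda>_ _. 0) z"
    unfolding sum_eq using z
  proof (cases rule: not_final_cases)
    case 1
    have "L0 / K = 1 + (\<Sum>g\<in>set_pmf p. enter g * real (k g - 1))"
      using K_pos by (simp add: L0_def)
    then show "1 + (\<Sum>v\<in>colours. trans_prob (colour z) v * profile 1 L0 (\<lambda>_ _. 0) (move z v))
        \<le> profile 1 L0 (\<lambda>_ _. 0) z"
      unfolding 1 colour.simps profile_start by (simp add: right_diff_distrib)
  next
    case (2 g i d)
    then show "1 + (\<Sum>v\<in>colours. trans_prob (colour z) v * profile 1 L0 (\<lambda>_ _. 0) (move z v))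
        \<le> profile 1 L0 (\<lambda>_ _. 0) z"
      using profile_inside[OF 2(2-4), of 1 L0 "\<lambda>_ _. 0" d] by (simp only: colour.simps)
  qed
next
  fix z assume "z \<in> phases"
  then show "profile 1 L0 (\<lambda>_ _. 0) z \<ge> 0"
    by (cases rule: phases_cases) (auto simp: L0_nonneg)
next
  fix g assume g: "g \<in> carrier G"
  define b where "b a d = (of_bool ((if d then a else inv a) = g) :: real)" for a d
  \<comment> \<open>The root value \<open>pmf p g\<close> is the solution \<open>a\<close> of a (1 -
    1 / K) + p(g) / K = a, the harmonic equation at \<open>Start\<close>.\<close>
  define h where "h = profile 0 (pmf p g) b"
  have "0 \<le> h z \<and> h z \<le> 1" if "z \<in> phases" for z
    using that
  proof (cases rule: phases_cases)
    case (2 a i d)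
    \<comment> \<open>Inside a loop \<open>h\<close> is a convex combination of its values at the
      two ends.\<close>
    have conv: "0 \<le> s * u + t * v \<and> s * u + t * v \<le> 1"
      if "0 \<le> s" "0 \<le> t" "s + t = 1" "0 \<le> u" "u \<le> 1" "0 \<le> v" "v \<le> 1" for s t u v :: real
      using that convex_bound_le[of u 1 v s t] by auto
    have "real (k a - i) / real (k a) + real i / real (k a) = 1"
      using 2 by (simp add: add_divide_distrib[symmetric])
    then show ?thesis
      unfolding h_def b_def 2 profile.simps
      using conv[of "real (k a - i) / real (k a)" "real i / real (k a)" "pmf p g" "b a d"]
        conv[of "real i / real (k a)" "real (k a - i) / real (k a)" "pmf p g" "b a d"]
      by (auto simp: b_def pmf_le_1 add.commute)
  qed (auto simp: h_def b_def pmf_le_1)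
  moreover have "(\<Sum>c\<in>{1..r}. transition (enc (colour z)) c * h (move z (dec c))) = h z"
    if z: "z \<in> phases - final" for z
  proof -
    have "(\<Sum>c\<in>{1..r}. transition (enc (colour z)) c * h (move z (dec c))) =
        (\<Sum>v\<in>colours. trans_prob (colour z) v * h (move z v))"
      using z colour_mem[of z] unfolding transition_def
      by (subst sum_dec[symmetric]) (simp add: dec_enc)
    also have "\<dots> = h z"
      using z
    proof (cases rule: not_final_cases)
      case 1
      have "(\<Sum>a\<in>set_pmf p. pmf p a * ((1 - \<beta>) * b a True + \<beta> * b a False)) = pmf p g"
        unfolding b_def using exit_weight[OF g] by simp
      then show ?thesis
        unfolding 1 colour.simps h_def profile_start by (simp add: algebra_simps)
    next
      case (2 a i d)
      then show ?thesis
        using profile_inside[OF 2(2-4), of 0 "pmf p g" b d] by (simp only: h_def colour.simps add_0)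
    qed
    finally show ?thesis .
  qed
  moreover have "h z = of_bool (shift z = g)" if "z \<in> phases \<inter> final" for z
    using that by (auto simp: final_def h_def b_def)
  ultimately show "\<exists>h. (\<forall>z\<in>phases. 0 \<le> h z \<and> h z \<le> 1) \<and>
      (\<forall>z\<in>phases - final. (\<Sum>c\<in>{1..r}. transition (enc (colour z)) c * h (move z (dec c))) = h z) \<and>
      (\<forall>z\<in>phases \<inter> final. h z = of_bool (shift z = g)) \<and> h Start = pmf p g"
    by (intro exI[of _ h]) (auto simp: h_def)
next
  show "enc (colour z) = 1" if "z \<in> phases \<inter> final" for z
    using that by (auto simp: final_def enc_None)
  show "Start \<in> phases - final"
    by (auto simp: phases_def final_def)
  show "shift z \<in> carrier G" if "z \<in> phases" for z
    using that x_closed support_closed by (cases rule: phases_cases) auto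
next
  fix z c assume z: "z \<in> phases - final" and c: "c \<in> {1..r}"
  from move_mem[OF z dec_mem[OF c]] show "move z (dec c) \<in> phases" "enc (colour (move z (dec c))) = c"
    using enc_dec[OF c] by auto
  assume "transition (enc (colour z)) c > 0"
  then show "shift (move z (dec c)) = shift z \<otimes> label (dec (enc (colour z))) (dec c)"
    using shift_move[OF z dec_mem[OF c]] z colour_mem[of z] by (simp add: transition_def dec_enc)
qed (use trans_prob_nonneg enc_mem colour_mem enc_None countable_carrier irreducible_transition
    label_closed dec_mem label_S labels_generate in \<open>simp_all add: transition_def\<close>)

section \<open>Reversibility for symmetric entrances\<close>

context loop_network
begin

text \<open>The reversible measure of an electrical network in which every edge of the loop of
  \<open>g\<close> has conductance \<open>enter g / 2\<close>: interior vertices get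
  \<open>enter g\<close>, and the root gets the sum of all \<open>enter g\<close>, which is
  1.\<close>

definition \<pi> :: "('a \<times> nat) option \<Rightarrow> real" where
  "\<pi> c = (case c of None \<Rightarrow> 1 | Some (g, i) \<Rightarrow> enter g) / (1 + (\<Sum>g\<in>set_pmf p. enter g * real (k g - 1)))"

text \<open>For \<beta> = 1/2 the flow from the root into either end of a loop is
  \<open>enter g / 2\<close>, equal to the flow back. Inside a loop \<open>nxt\<close> and
  \<open>prv\<close> are converse to each other.\<close>

lemma detailed_balance:
  assumes \<beta>_half: "\<beta> = 1 / 2" and u: "u \<in> colours" and v: "v \<in> colours"
  shows "\<pi> u * trans_prob u v = \<pi> v * trans_prob v u"
proof -
  have *: "trans_prob None (Some (g, i)) = enter g * trans_prob (Some (g, i)) None"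
    if "g \<in> set_pmf p" "1 \<le> i" "i < k g" for g i
    unfolding trans_prob.simps using that by (auto simp: \<beta>_half of_bool_def)
  have **: "enter g * trans_prob (Some (g, i)) (Some (h, j)) = enter h * trans_prob (Some (h, j)) (Some (g, i))"
    if "g \<in> set_pmf p" "1 \<le> i" "i < k g" "h \<in> set_pmf p" "1 \<le> j" "j < k h" for g i h j
  proof -
    have nxt_prv: "Some (b, m) = nxt (a, l) \<longleftrightarrow> Some (a, l) = prv (b, m)"
      if "1 \<le> l" "1 \<le> m" "m < k b" for a b l m
      using that by (auto split: if_splits)
    have sym: "trans_prob (Some (g, i)) (Some (h, j)) = trans_prob (Some (h, j)) (Some (g, i))"
      unfolding trans_prob.simps nxt_prv[OF that(2,5,6)] nxt_prv[OF that(5,2,3)]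
      by (simp only: add.commute)
    show ?thesis
    proof (cases "g = h")
      case True
      with sym show ?thesis by (simp only:)
    next
      case False
      then have "trans_prob (Some (g, i)) (Some (h, j)) = 0" by simp
      with sym show ?thesis by (simp only: mult_zero_right)
    qed
  qed
  have \<pi>_Some: "\<pi> (Some (g, i)) = \<pi> None * enter g" for g i
    by (simp add: \<pi>_def)
  from u show ?thesis
  proof (cases rule: colours_cases)
    case u: 1
    from v show ?thesis
    proof (cases rule: colours_cases)
      case 1
      with u show ?thesis by simp
    next
      case (2 g i)
      show ?thesis
        unfolding u(1) 2(1) \<pi>_Some *[OF 2(2-4)] by (simp only: mult.assoc)
    qed
  next
    case u: (2 g i)
    from v show ?thesis
    proof (cases rule: colours_cases)
      case 1
      show ?thesis
        unfolding u(1) 1 \<pi>_Some *[OF u(2-4)] by (simp only: mult.assoc)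
    next
      case (2 h j)
      show ?thesis
        unfolding u(1) 2(1) \<pi>_Some mult.assoc
        by (rule arg_cong[where f="\<lambda>t. \<pi> None * t", OF **[OF u(2-4) 2(2-4)]])
    qed
  qed
qed

lemma \<pi>_sum: "(\<Sum>c\<in>colours. \<pi> c) = 1"
proof -
  let ?D = "1 + (\<Sum>g\<in>set_pmf p. enter g * real (k g - 1))"
  have D: "?D > 0"
    using enter_nonneg by (intro add_pos_nonneg sum_nonneg) auto
  have "(\<Sum>c\<in>colours. \<pi> c) = \<pi> None + (\<Sum>v\<in>vertices. \<pi> (Some v))"
    using finite_support by (subst sum.insert) (auto simp: sum.reindex)
  also have "(\<Sum>v\<in>vertices. \<pi> (Some v)) = (\<Sum>g\<in>set_pmf p. \<Sum>i\<in>{1..<k g}. \<pi> (Some (g, i)))"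
    using finite_support by (subst sum.Sigma) auto
  also have "\<pi> None + \<dots> = ?D / ?D"
  proof -
    have "(\<Sum>g\<in>set_pmf p. \<Sum>i\<in>{1..<k g}. \<pi> (Some (g, i))) =
        (\<Sum>g\<in>set_pmf p. enter g * real (k g - 1) / ?D)"
      by (simp add: \<pi>_def mult.commute)
    also have "\<dots> = (\<Sum>g\<in>set_pmf p. enter g * real (k g - 1)) / ?D"
      by (simp only: sum_divide_distrib)
    moreover have "\<pi> None = 1 / ?D"
      by (simp add: \<pi>_def)
    ultimately show ?thesis
      by (simp only: add_divide_distrib)
  qed
  finally show ?thesis using D by simp
qed

lemma reversible:
  assumes "\<beta> = 1 / 2"
  shows "coloured_reversible G r walk"
  unfolding coloured_reversible_def
proof (intro exI[of _ "\<lambda>u. \<pi> (dec u)"] conjI ballI)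
  have bal: "\<pi> (dec u) * transition u v = \<pi> (dec v) * transition v u"
    if "u \<in> {1..r}" "v \<in> {1..r}" for u v
    unfolding transition_def by (rule detailed_balance[OF assms dec_mem[OF that(1)] dec_mem[OF that(2)]])
  show "invariant_probability r (colour_matrix G walk) (\<lambda>u. \<pi> (dec u))"
    unfolding invariant_probability_def
  proof (intro conjI ballI)
    show "\<pi> (dec u) \<ge> 0" for u
      unfolding \<pi>_def using enter_nonneg
      by (intro divide_nonneg_nonneg add_nonneg_nonneg sum_nonneg) (auto split: option.splits)
    show "(\<Sum>u\<in>{1..r}. \<pi> (dec u)) = 1"
      by (simp only: sum_dec \<pi>_sum)
    fix v assume v: "v \<in> {1..r}"
    have "(\<Sum>u\<in>{1..r}. \<pi> (dec u) * colour_matrix G walk u v) = (\<Sum>u\<in>{1..r}. \<pi> (dec v) * transition v u)"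
      by (rule sum.cong) (simp_all only: colour_matrix_walk bal v)
    also have "\<dots> = \<pi> (dec v)"
      using P_sum[OF v] by (simp only: sum_distrib_left[symmetric] mult_1_right)
    finally show "(\<Sum>u\<in>{1..r}. \<pi> (dec u) * colour_matrix G walk u v) = \<pi> (dec v)" .
  qed
  fix g u v assume g: "g \<in> carrier G" and uv: "u \<in> {1..r}" "v \<in> {1..r}"
  \<comment> \<open>A step from \<open>v\<close> back to \<open>u\<close> carries the inverse label,
    so the group condition reduces to detailed balance of the colours.\<close>
  have "inv g = label (dec v) (dec u) \<longleftrightarrow> g = label (dec u) (dec v)"
    using label_inv[OF dec_mem[OF uv(1)] dec_mem[OF uv(2)]] g
      label_closed[OF dec_mem[OF uv(1)] dec_mem[OF uv(2)]] by (metis inv_inv)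
  then show "\<pi> (dec u) * walk g u v = \<pi> (dec v) * walk (inv g) v u"
    using bal[OF uv] by (simp add: walk_def)
qed

end

section \<open>Loops from words, numbering of the colours, and assembly\<close>

lemma (in group) path_of_word:
  assumes "set xs \<subseteq> carrier G" "i < length xs"
  shows "inv (list_mult (take i xs)) \<otimes> list_mult (take (Suc i) xs) = xs ! i"
proof -
  have mem: "list_mult (take i xs) \<in> carrier G" "xs ! i \<in> carrier G" "set (take i xs) \<subseteq> carrier G"
    using assms by (auto intro!: list_mult_closed dest: in_set_takeD)
  have "list_mult (take (Suc i) xs) = list_mult (take i xs) \<otimes> xs ! i"
    using assms mem list_mult_append[of "take i xs" "[xs ! i]"]
    by (simp add: take_Suc_conv_app_nth del: foldr_append)
  then show ?thesis
    using mem by (metis inv_closed inv_solve_left m_closed)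
qed

lemma (in group) Cayley_path:
  assumes S: "S \<subseteq> carrier G" "S \<noteq> {}" "\<forall>s\<in>S. inv s \<in> S" and g: "g \<in> generate G S"
  obtains n x where "3 \<le> n" "x 0 = \<one>" "x n = g" "\<And>i. x i \<in> carrier G"
    "\<And>i. i < n \<Longrightarrow> inv (x i) \<otimes> x (Suc i) \<in> S"
proof -
  have "S \<union> m_inv G ` S = S" using S(3) by auto
  then obtain xs where xs: "set xs \<subseteq> S" "g = list_mult xs"
    using g generate_eq_list_mult[OF S(1)] by (auto simp: lists_eq_set)
  obtain s where s: "s \<in> S" using S(2) by auto
  \<comment> \<open>The padding multiplies to the identity and makes every word long enough. Four
    letters are appended because two would leave the empty word, which may represent the identity,
    too short.\<close>
  define ys where "ys = xs @ [s, inv s, s, inv s]"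
  have ys: "set ys \<subseteq> S" using xs s S(3) by (simp add: ys_def)
  then have ys': "set ys \<subseteq> carrier G" using S(1) by blast
  have "list_mult [s, inv s, s, inv s] = \<one>"
    using s S(1) by auto
  then have "list_mult ys = g"
    using xs ys' S(1) list_mult_closed[of xs] unfolding ys_def
    by (subst list_mult_append) auto
  moreover have "set (take i ys) \<subseteq> carrier G" for i
    using ys' by (auto dest: in_set_takeD)
  ultimately show ?thesis
    using ys path_of_word[OF ys']
    by (intro that[of "length ys" "\<lambda>i. list_mult (take i ys)"]) (auto simp: list_mult_closed, simp add: ys_def)
qed

text \<open>The root has to be colour 1, the colour prescribed at the renewal times; the other
  colours are numbered after it.\<close>

lemma bij_betw_root:
  assumes "finite V"
  obtains r and dec :: "nat \<Rightarrow> 'v option"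
  where "1 \<le> r" "dec 1 = None" "bij_betw dec {1..r} (insert None (Some ` V))"
proof -
  obtain h where h: "bij_betw h {1..card V} V"
    using ex_bij_betw_nat_finite_1[OF assms] by blast
  let ?dec = "\<lambda>j. if j = 1 then None else Some (h (j - 1))"
  have img: "h ` {1..card V} = V" and inj: "inj_on h {1..card V}"
    using h by (auto simp: bij_betw_def)
  have "bij_betw ?dec {1..Suc (card V)} (insert None (Some ` V))"
    unfolding bij_betw_def
  proof
    show "inj_on ?dec {1..Suc (card V)}"
    proof (rule inj_onI)
      fix a b assume ab: "a \<in> {1..Suc (card V)}" "b \<in> {1..Suc (card V)}" "?dec a = ?dec b"
      show "a = b"
      proof (cases "a = 1 \<or> b = 1")
        case False
        then have "h (a - 1) = h (b - 1)" "a - 1 \<in> {1..card V}" "b - 1 \<in> {1..card V}"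
          using ab by auto
        then have "a - 1 = b - 1" using inj by (auto dest: inj_onD)
        then show ?thesis using False ab by auto
      qed (use ab in \<open>auto split: if_splits\<close>)
    qed
    have "{1..Suc (card V)} = insert 1 (Suc ` {1..card V})"
      by (auto simp: image_iff)
    moreover have "?dec ` (Suc ` {1..card V}) = (\<lambda>j. Some (h j)) ` {1..card V}"
      unfolding image_image by (rule image_cong) auto
    moreover have "\<dots> = Some ` h ` {1..card V}"
      by (simp only: image_image)
    ultimately show "?dec ` {1..Suc (card V)} = insert None (Some ` V)"
      by (simp only: image_insert img simp_thms if_True)
  qed
  then show ?thesis by (intro that[of "Suc (card V)" ?dec]) auto
qed

lemma (in group) exists_linearizing_walk:
  fixes \<beta> :: real
  assumes S: "finite S" "S \<noteq> {}" "S \<subseteq> carrier G" "\<forall>g\<in>S. inv g \<in> S" "generate G S = carrier G"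
    and p: "set_pmf p \<subseteq> carrier G" "finite (set_pmf p)" "generate G (set_pmf p) = carrier G"
    and \<beta>: "0 \<le> \<beta>" "\<beta> < 1"
    and balance: "\<And>g. g \<in> carrier G \<Longrightarrow> (1 - \<beta>) * pmf p g + \<beta> * pmf p (inv g) = pmf p g"
  shows "\<exists>r q. linearizes G S r q p \<and> (\<beta> = 1 / 2 \<longrightarrow> coloured_reversible G r q)"
proof -
  have "\<exists>n x. 3 \<le> n \<and> x 0 = \<one> \<and> x n = g \<and> (\<forall>i. x i \<in> carrier G) \<and>
      (\<forall>i<n. inv (x i) \<otimes> x (Suc i) \<in> S)" if "g \<in> set_pmf p" for g
  proof -
    have "g \<in> generate G S" using that p(1) S(5) by blast
    from Cayley_path[OF S(3,2,4) this] show ?thesis by metis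
  qed
  then obtain k x where kx: "\<And>g. g \<in> set_pmf p \<Longrightarrow> 3 \<le> k g \<and> x g 0 = \<one> \<and> x g (k g) = g \<and>
      (\<forall>i. x g i \<in> carrier G) \<and> (\<forall>i<k g. inv (x g i) \<otimes> x g (Suc i) \<in> S)"
    by metis
  have "finite (SIGMA g:set_pmf p. {1..<k g})"
    using p(2) by simp
  then obtain r and dec :: "nat \<Rightarrow> ('a \<times> nat) option" where dec: "1 \<le> r" "dec 1 = None"
    "bij_betw dec {1..r} (insert None (Some ` (SIGMA g:set_pmf p. {1..<k g})))"
    by (rule bij_betw_root)
  have "countable (carrier G)"
    using countable_generate[OF countable_finite[OF S(1)] S(3)] S(5) by simp
  then interpret loop_network G S p k x \<beta> r dec
    by unfold_locales (use S p \<beta> balance kx dec in blast)+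
  show ?thesis
    using linearizes reversible by blast
qed

theorem mainTheorem1:
  fixes G :: "('a, 'b) monoid_scheme" and S :: "'a set" and p :: "'a pmf"
  assumes "group G"
    and "finite S" and "S \<noteq> {}" and "S \<subseteq> carrier G"
    and "\<forall>g\<in>S. inv\<^bsub>G\<^esub> g \<in> S"
    and "generate G S = carrier G"
    and "set_pmf p \<subseteq> carrier G" and "finite (set_pmf p)"
    and "generate G (set_pmf p) = carrier G"
  shows "(\<exists>r q. r \<ge> 1 \<and> coloured_walk G r q \<and> linearizes G S r q p) \<and>
         (conv_reversible G p \<longrightarrow>
           (\<exists>r q. r \<ge> 1 \<and> coloured_walk G r q \<and> linearizes G S r q p \<and> coloured_reversible G r q))"
proof -
  have walk: "r \<ge> 1 \<and> coloured_walk G r q" if "linearizes G S r q p" for r q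
    using that by (simp add: linearizes_def coloured_walk_def)
  note exists = group.exists_linearizing_walk[OF assms]
  show ?thesis
  proof (intro conjI impI)
    show "\<exists>r q. r \<ge> 1 \<and> coloured_walk G r q \<and> linearizes G S r q p"
      \<comment> \<open>With \<beta> = 0 the balance condition is trivial for every
        \<open>p\<close>.\<close>
      using exists[of 0] walk by auto
    assume "conv_reversible G p"
    \<comment> \<open>With \<beta> = 1/2 the balance condition says that \<open>p\<close> is
      symmetric.\<close>
    then have "(1 - 1 / 2) * pmf p g + 1 / 2 * pmf p (inv\<^bsub>G\<^esub> g) = pmf p g" if "g \<in> carrier G" for g
      using that by (simp add: conv_reversible_def)
    with exists[of "1 / 2"] walk
    show "\<exists>r q. r \<ge> 1 \<and> coloured_walk G r q \<and> linearizes G S r q p \<and> coloured_reversible G r q"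
      by auto
  qed
qed

end
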